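(* Let $q$ be a prime power, $n \geq 2$, and $V=\mathbb{F}_q^n$. For $\mathbf{v}\in T_{q,n}$ let $\widetilde{c}_{\mathbf{v}}=(f_{\mathbf{v}})_*c_{\mathbf{v}}\in\tilde{H}_{n-2}(X_V;\mathfrak{g})$ be the class defined in the context. Then the family $\{\widetilde{c}_{\mathbf{v}}:\mathbf{v}\in T_{q,n}\}$ is a basis of the $\mathbb{F}_q$-vector space $\mathcal{D}^1(V)=\tilde{H}_{n-2}(X_V;\mathfrak{g})$ (that is, the $\widetilde{c}_{\mathbf{v}}$, indexed by $\mathbf{v}\in T_{q,n}$, are linearly independent and span).
   Context: Local systems. Let $X$ be a finite simplicial complex (containing the empty simplex $\emptyset$, of dimension $-1$) with a fixed linear order on its vertices; $X(p)$ is the set of $p$-dimensional simplices and $X^{(p)}$ the $p$-skeleton. For $\sigma=[s_1,\ldots,s_{p+1}]\in X(p)$ written in increasing order, $\sigma_i$ denotes the face obtained by deleting $s_i$. A local system $\mathcal{F}$ on $X$ assigns an abelian group $\mathcal{F}(\sigma)$ to each simplex $\sigma\in X$ (including $\emptyset$), together with homomorphisms $\rho_\sigma^\tau:\mathcal{F}(\tau)\to\mathcal{F}(\sigma)$ for $\sigma\subset\tau$, with $\rho_\sigma^\sigma=\mathrm{id}$ and $\rho_\eta^\sigma\rho_\sigma^\tau=\rho_\eta^\tau$ for $\eta\subset\sigma\subset\tau$. The group $C_p(X;\mathcal{F})$ consists of formal sums $\sum_{\sigma\in X(p)}c(\sigma)\sigma$ with $c(\sigma)\in\mathcal{F}(\sigma)$,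 and $\partial_p\big(\sum_\sigma c(\sigma)\sigma\big)=\sum_{\sigma\in X(p)}\sum_{i=1}^{p+1}(-1)^{i+1}\rho_{\sigma_i}^\sigma(c(\sigma))\,\sigma_i$ for $p\ge 0$. The reduced homology $\tilde{H}_*(X;\mathcal{F})$ is the homology of $\bigoplus_{p\ge -1}C_p(X;\mathcal{F})$. If $f:X\to Y$ is a simplicial map with $\dim f(\sigma)=\dim\sigma$ for all $\sigma$, and $\mathcal{G}$ is a local system on $Y$, then $f^{-1}\mathcal{G}$ is the local system $\sigma\mapsto\mathcal{G}(f(\sigma))$ on $X$, and $f_*:\tilde{H}_p(X;f^{-1}\mathcal{G})\to\tilde{H}_p(Y;\mathcal{G})$ is the map induced by $c(\sigma)\sigma\mapsto c(\sigma)f(\sigma)$ (below, $f$ will preserve the vertex orderings of simplices). The complex $X_V$ has as vertices the linear subspaces $0\ne U\subsetneq V$ and as simplices the flags $\{U_0\subsetneq\cdots\subsetneq U_p\}$; vertices are ordered so that $U$ precedes $U'$ if $\dim U<\dim U'$. The local system $\mathfrak{g}$ on $X_V$ is $\mathfrak{g}([U_0\subsetneq\cdots\subsetneq U_p])=U_0$, $\mathfrak{g}(\emptyset)=V$, with inclusions as connecting maps. Since $\dim X_V=n-2$, $\tilde H_{n-2}(X_V;\mathfrak{g})=\ker\partial_{n-2}$. Let $e_1,\ldots,e_n$ be the standard basis of $V$, $a\cdot b=\sum a_ib_i$, and $S^\perp=\{u\in V:u\cdot s=0\ \forall s\in S\}$; $\langle\cdot\rangle$ denotes linear span. The complex $K$.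 Let $a_1^0,a_1^1,\ldots,a_{n-1}^0,a_{n-1}^1,b$ be $2n-1$ distinct elements, let $M=\{a_1^0,a_1^1\}*\cdots*\{a_{n-1}^0,a_{n-1}^1\}$ (simplicial join; an octahedral $(n-2)$-sphere), and let $K=M\cup(\{b\}*M^{(n-3)})$. The barycentric subdivision $\mathrm{sd}(K)$ has as vertices the nonempty simplices of $K$, ordered so that $\sigma$ precedes $\tau$ if $\dim\sigma>\dim\tau$; its $p$-simplices are $[\sigma_1,\ldots,\sigma_{p+1}]$ with $\sigma_1\supsetneq\cdots\supsetneq\sigma_{p+1}$. For a sequence $\mathbf{x}=(x_1,\ldots,x_{n-1})$ of distinct vertices with $\{x_1,\ldots,x_{n-1}\}\in K$, put $S(\mathbf{x})=[\{x_1,\ldots,x_{n-1}\},\{x_1,\ldots,x_{n-2}\},\ldots,\{x_1\}]\in\mathrm{sd}(K)(n-2)$. For $\pi$ in the symmetric group $\mathbb{S}_{n-1}$ put $\pi(\mathbf{x})=(x_{\pi(1)},\ldots,x_{\pi(n-1)})$. Let $E=\{0,1\}^{n-1}$ and $E_j=\{\epsilon\in E:\epsilon_j=0\}$ for $1\le j\le n-1$; for $\epsilon\in E_j$, $\epsilon+e_j\in E$ is obtained from $\epsilon$ by changing the $j$-th coordinate to $1$. For $\epsilon\in E$ let $\mathbf{a}^\epsilon=(a_1^{\epsilon_1},\ldots,a_{n-1}^{\epsilon_{n-1}})$, and let $\mathbf{a}^{\epsilon,j}$ be $\mathbf{a}^\epsilon$ with its $j$-th entry replaced by $b$. Put $\chi(\epsilon,\pi)=(-1)^{\sum_j\epsilon_j}\mathrm{sgn}(\pi)$.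 The index set. $T_{q,n}$ is the set of all $\mathbf{v}=(v_1,\ldots,v_{n-1})\in V^{n-1}$ such that $v_i\in e_i+\langle e_{i+1},\ldots,e_n\rangle$ and $v_i\ne e_i$ for all $1\le i\le n-1$. For $\mathbf{v}\in T_{q,n}$ and $\epsilon\in E$ let $\mathbf{v}^\epsilon=(u_1,\ldots,u_{n-1})$ with $u_i=e_i$ if $\epsilon_i=0$ and $u_i=v_i$ if $\epsilon_i=1$. For linearly independent $\mathbf{u}=(u_1,\ldots,u_{n-1})$ with $e_n\notin\langle u_1,\ldots,u_{n-1}\rangle$, let $w(\mathbf{u})$ be the unique $w\in\langle u_1,\ldots,u_{n-1}\rangle^\perp$ with $w\cdot e_n=1$. The map $f_{\mathbf{v}}$ and the cycle $c_{\mathbf{v}}$. Let $\theta_{\mathbf{v}}(a_i^0)=e_i$, $\theta_{\mathbf{v}}(a_i^1)=v_i$, $\theta_{\mathbf{v}}(b)=e_n$, and let $f_{\mathbf{v}}(\sigma)=\langle\theta_{\mathbf{v}}(x):x\in\sigma\rangle^\perp$ for each nonempty simplex $\sigma$ of $K$; this extends to a dimension-preserving simplicial map $f_{\mathbf{v}}:\mathrm{sd}(K)\to X_V$. Let $\mathfrak{h}_{\mathbf{v}}=f_{\mathbf{v}}^{-1}\mathfrak{g}$. The chain $c_{\mathbf{v}}\in C_{n-2}(\mathrm{sd}(K);\mathfrak{h}_{\mathbf{v}})$ is defined by $$c_{\mathbf{v}}(F)=\begin{cases}\chi(\epsilon,\pi)\,w(\mathbf{v}^\epsilon) & F=S(\pi(\mathbf{a}^\epsilon)),\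 \epsilon\in E,\ \pi\in\mathbb{S}_{n-1},\\ \chi(\epsilon,\pi)\big(w(\mathbf{v}^{\epsilon+e_j})-w(\mathbf{v}^\epsilon)\big) & F=S(\pi(\mathbf{a}^{\epsilon,j})),\ 1\le j\le n-1,\ \epsilon\in E_j,\ \pi\in\mathbb{S}_{n-1},\\ 0&\text{otherwise.}\end{cases}$$ It is a cycle, i.e. $\partial_{n-2}c_{\mathbf{v}}=0$, so it defines an element of $\tilde H_{n-2}(\mathrm{sd}(K);\mathfrak{h}_{\mathbf{v}})$, and $\widetilde c_{\mathbf{v}}=(f_{\mathbf{v}})_*c_{\mathbf{v}}$ is well defined. *)

theory Defs
  imports
    Complex_Main
    "HOL-Library.Function_Algebras"
    "HOL-Library.FuncSet"
    "HOL-Combinatorics.Permutations"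
begin

section \<open>Local systems on ordered simplicial complexes\<close>

text \<open>
  A complex is the set of its simplices, the empty simplex included. Its vertices are ordered by a
  strict relation \<open>prec\<close> of which only the restriction to each simplex matters, and which has to be a
  linear order there. The groups \<open>stalk L \<sigma>\<close> are subgroups of a common ambient group; \<open>restr L \<sigma> \<tau>\<close>
  is the connecting map from \<open>stalk L \<tau>\<close> to \<open>stalk L \<sigma>\<close> for \<open>\<sigma> \<subseteq> \<tau>\<close>.
\<close>

record ('v, 'm) local_sys =
  stalk :: "'v set \<Rightarrow> 'm set"
  restr :: "'v set \<Rightarrow> 'v set \<Rightarrow> 'm \<Rightarrow> 'm"

definition local_system :: "'v set set \<Rightarrow> ('v, 'm::ab_group_add) local_sys \<Rightarrow> bool" where
  "local_system X L \<longleftrightarrow>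
     (\<forall>\<sigma>\<in>X. 0 \<in> stalk L \<sigma> \<and> (\<forall>x\<in>stalk L \<sigma>. - x \<in> stalk L \<sigma> \<and> (\<forall>y\<in>stalk L \<sigma>. x + y \<in> stalk L \<sigma>))) \<and>
     (\<forall>\<tau>\<in>X. \<forall>\<sigma>\<in>X. \<sigma> \<subseteq> \<tau> \<longrightarrow>
        (\<forall>x\<in>stalk L \<tau>. restr L \<sigma> \<tau> x \<in> stalk L \<sigma> \<and>
           (\<forall>y\<in>stalk L \<tau>. restr L \<sigma> \<tau> (x + y) = restr L \<sigma> \<tau> x + restr L \<sigma> \<tau> y))) \<and>
     (\<forall>\<sigma>\<in>X. \<forall>x\<in>stalk L \<sigma>. restr L \<sigma> \<sigma> x = x) \<and>
     (\<forall>\<tau>\<in>X. \<forall>\<sigma>\<in>X. \<forall>\<eta>\<in>X. \<eta> \<subseteq> \<sigma> \<longrightarrow> \<sigma> \<subseteq> \<tau> \<longrightarrow>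
        (\<forall>x\<in>stalk L \<tau>. restr L \<eta> \<sigma> (restr L \<sigma> \<tau> x) = restr L \<eta> \<tau> x))"

definition simplices :: "'v set set \<Rightarrow> int \<Rightarrow> 'v set set" where
  "simplices X p = {\<sigma> \<in> X. finite \<sigma> \<and> int (card \<sigma>) = p + 1}"

definition skeleton :: "'v set set \<Rightarrow> int \<Rightarrow> 'v set set" where
  "skeleton X p = {\<sigma> \<in> X. finite \<sigma> \<and> int (card \<sigma>) \<le> p + 1}"

text \<open>A formal sum is encoded by its coefficient function, extended by 0.\<close>

definition chain_group :: "'v set set \<Rightarrow> ('v, 'm::ab_group_add) local_sys \<Rightarrow> int \<Rightarrow> ('v set \<Rightarrow> 'm) set" where
  "chain_group X L p =
     {c. (\<forall>\<sigma>\<in>simplices X p. c \<sigma> \<in> stalk L \<sigma>) \<and> (\<forall>\<sigma>. \<sigma> \<notin> simplices X p \<longrightarrow> c \<sigma> = 0)}"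

definition single :: "'v set \<Rightarrow> 'm \<Rightarrow> 'v set \<Rightarrow> 'm::ab_group_add" where
  "single \<sigma> m = (\<lambda>\<tau>. if \<tau> = \<sigma> then m else 0)"

definition signed :: "nat \<Rightarrow> 'm \<Rightarrow> 'm::ab_group_add" where
  "signed k m = (if even k then m else - m)"

text \<open>The index \<open>i\<close> with \<open>s = s\<^sub>i\<close> when \<open>\<sigma> = [s\<^sub>1, \<dots>, s\<^sub>p\<^sub>+\<^sub>1]\<close> is written in increasing order.\<close>

definition position :: "('v \<Rightarrow> 'v \<Rightarrow> bool) \<Rightarrow> 'v set \<Rightarrow> 'v \<Rightarrow> nat" where
  "position prec \<sigma> s = card {t \<in> \<sigma>. prec t s} + 1"

definition boundary ::
    "('v \<Rightarrow> 'v \<Rightarrow> bool) \<Rightarrow> 'v set set \<Rightarrow> ('v, 'm::ab_group_add) local_sys \<Rightarrow> int \<Rightarrow>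
     ('v set \<Rightarrow> 'm) \<Rightarrow> ('v set \<Rightarrow> 'm)" where
  "boundary prec X L p c =
     (\<Sum>\<sigma>\<in>simplices X p. \<Sum>s\<in>\<sigma>.
        single (\<sigma> - {s}) (signed (position prec \<sigma> s + 1) (restr L (\<sigma> - {s}) \<sigma> (c \<sigma>))))"

definition cycle_group ::
    "('v \<Rightarrow> 'v \<Rightarrow> bool) \<Rightarrow> 'v set set \<Rightarrow> ('v, 'm::ab_group_add) local_sys \<Rightarrow> int \<Rightarrow> ('v set \<Rightarrow> 'm) set" where
  "cycle_group prec X L p = {c \<in> chain_group X L p. boundary prec X L p c = 0}"

definition boundary_group ::
    "('v \<Rightarrow> 'v \<Rightarrow> bool) \<Rightarrow> 'v set set \<Rightarrow> ('v, 'm::ab_group_add) local_sys \<Rightarrow> int \<Rightarrow> ('v set \<Rightarrow> 'm) set" where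
  "boundary_group prec X L p = boundary prec X L (p + 1) ` chain_group X L (p + 1)"

definition pullback :: "('v \<Rightarrow> 'w) \<Rightarrow> ('w, 'm) local_sys \<Rightarrow> ('v, 'm) local_sys" where
  "pullback f L = \<lparr>stalk = (\<lambda>\<sigma>. stalk L (f ` \<sigma>)), restr = (\<lambda>\<sigma> \<tau>. restr L (f ` \<sigma>) (f ` \<tau>))\<rparr>"

definition push_forward ::
    "('v \<Rightarrow> 'w) \<Rightarrow> 'v set set \<Rightarrow> int \<Rightarrow> ('v set \<Rightarrow> 'm) \<Rightarrow> ('w set \<Rightarrow> 'm::ab_group_add)" where
  "push_forward f X p c = (\<Sum>\<sigma>\<in>simplices X p. single (f ` \<sigma>) (c \<sigma>))"

definition flag_complex :: "'b set set \<Rightarrow> 'b set set set" where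
  "flag_complex P = {C. finite C \<and> C \<subseteq> P \<and> chain\<^sub>\<subseteq> C}"


section \<open>The space \<open>V = F\<^sub>q\<^sup>n\<close>\<close>

text \<open>
  The field is a type of class \<open>field\<close> that will also be of class \<open>finite\<close>. Vectors are functions on
  \<open>nat\<close> that vanish outside \<open>{1..n}\<close>.
\<close>

definition vscale :: "'a::field \<Rightarrow> (nat \<Rightarrow> 'a) \<Rightarrow> nat \<Rightarrow> 'a" where
  "vscale k u = (\<lambda>i. k * u i)"

definition cscale :: "'a::field \<Rightarrow> ('s \<Rightarrow> nat \<Rightarrow> 'a) \<Rightarrow> 's \<Rightarrow> nat \<Rightarrow> 'a" where
  "cscale k c = (\<lambda>\<sigma>. vscale k (c \<sigma>))"

interpretation vct: vector_space vscale
  by unfold_locales (auto simp: vscale_def fun_eq_iff algebra_simps)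

interpretation chn: vector_space cscale
  by unfold_locales (auto simp: cscale_def vscale_def fun_eq_iff algebra_simps)

definition Vsp :: "nat \<Rightarrow> (nat \<Rightarrow> 'a::field) set" where
  "Vsp n = {u. \<forall>i. i \<notin> {1..n} \<longrightarrow> u i = 0}"

definition stdvec :: "nat \<Rightarrow> nat \<Rightarrow> 'a::field" where
  "stdvec i = (\<lambda>j. if j = i then 1 else 0)"

definition dotp :: "nat \<Rightarrow> (nat \<Rightarrow> 'a::field) \<Rightarrow> (nat \<Rightarrow> 'a) \<Rightarrow> 'a" where
  "dotp n a b = (\<Sum>i=1..n. a i * b i)"

definition orth :: "nat \<Rightarrow> (nat \<Rightarrow> 'a::field) set \<Rightarrow> (nat \<Rightarrow> 'a) set" where
  "orth n A = {u \<in> Vsp n. \<forall>s\<in>A. dotp n u s = 0}"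


section \<open>The complex \<open>X\<^sub>V\<close> and the local system \<open>\<gg>\<close>\<close>

definition XV :: "nat \<Rightarrow> (nat \<Rightarrow> 'a::field) set set set" where
  "XV n = flag_complex {U. vct.subspace U \<and> U \<noteq> {0} \<and> U \<subset> Vsp n}"

definition dim_prec :: "(nat \<Rightarrow> 'a::field) set \<Rightarrow> (nat \<Rightarrow> 'a) set \<Rightarrow> bool" where
  "dim_prec U U' \<longleftrightarrow> vct.dim U < vct.dim U'"

text \<open>The intersection of a nonempty finite flag is its least member.\<close>

definition gsys :: "nat \<Rightarrow> ((nat \<Rightarrow> 'a::field) set, nat \<Rightarrow> 'a) local_sys" where
  "gsys n = \<lparr>stalk = (\<lambda>\<sigma>. if \<sigma> = {} then Vsp n else \<Inter>\<sigma>), restr = (\<lambda>\<sigma> \<tau> x. x)\<rparr>"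

text \<open>
  Homology in the top dimension \<open>n - 2\<close> is the group of cycles; the lemma \<open>boundary_group_XV\<close> below
  shows that the boundaries vanish.
\<close>

definition D1 :: "nat \<Rightarrow> ((nat \<Rightarrow> 'a::field) set set \<Rightarrow> nat \<Rightarrow> 'a) set" where
  "D1 n = cycle_group dim_prec (XV n) (gsys n) (int n - 2)"


section \<open>The complex \<open>K\<close> and its barycentric subdivision\<close>

text \<open>\<open>KA i k\<close> with \<open>1 \<le> i \<le> n - 1\<close> and \<open>k \<in> {0, 1}\<close> stands for \<open>a\<^sub>i\<^sup>k\<close>.\<close>

datatype kvertex = KA nat nat | KB

definition join :: "'v set set \<Rightarrow> 'v set set \<Rightarrow> 'v set set" where
  "join X Y = {\<sigma> \<union> \<tau> | \<sigma> \<tau>. \<sigma> \<in> X \<and> \<tau> \<in> Y}"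

definition Join :: "'i set \<Rightarrow> ('i \<Rightarrow> 'v set set) \<Rightarrow> 'v set set" where
  "Join I X = {\<Union>i\<in>I. s i | s. \<forall>i\<in>I. s i \<in> X i}"

definition Mcx :: "nat \<Rightarrow> kvertex set set" where
  "Mcx n = Join {1..n-1} (\<lambda>i. {{}, {KA i 0}, {KA i 1}})"

definition Kcx :: "nat \<Rightarrow> kvertex set set" where
  "Kcx n = Mcx n \<union> join {{}, {KB}} (skeleton (Mcx n) (int n - 3))"

definition sd :: "'v set set \<Rightarrow> 'v set set set" where
  "sd X = flag_complex (X - {{}})"

definition Sflag :: "nat \<Rightarrow> (nat \<Rightarrow> 'v) \<Rightarrow> 'v set set" where
  "Sflag n x = {x ` {1..k} | k. k \<in> {1..n-1}}"

definition Eset :: "nat \<Rightarrow> (nat \<Rightarrow> nat) set" where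
  "Eset n = {1..n-1} \<rightarrow>\<^sub>E {0, 1}"

definition Eset0 :: "nat \<Rightarrow> nat \<Rightarrow> (nat \<Rightarrow> nat) set" where
  "Eset0 n j = {\<epsilon> \<in> Eset n. \<epsilon> j = 0}"

definition avec :: "(nat \<Rightarrow> nat) \<Rightarrow> nat \<Rightarrow> kvertex" where
  "avec \<epsilon> = (\<lambda>i. KA i (\<epsilon> i))"

definition avecb :: "(nat \<Rightarrow> nat) \<Rightarrow> nat \<Rightarrow> nat \<Rightarrow> kvertex" where
  "avecb \<epsilon> j = (avec \<epsilon>)(j := KB)"

definition chi :: "nat \<Rightarrow> (nat \<Rightarrow> nat) \<Rightarrow> (nat \<Rightarrow> nat) \<Rightarrow> int" where
  "chi n \<epsilon> \<pi> = (-1) ^ (\<Sum>j=1..n-1. \<epsilon> j) * sign \<pi>"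


section \<open>The index set and the classes\<close>

definition Tset :: "nat \<Rightarrow> (nat \<Rightarrow> nat \<Rightarrow> 'a::field) set" where
  "Tset n = (\<Pi>\<^sub>E i\<in>{1..n-1}.
     {stdvec i + y | y. y \<in> vct.span (stdvec ` {i+1..n})} - {stdvec i})"

definition veps :: "(nat \<Rightarrow> nat \<Rightarrow> 'a::field) \<Rightarrow> (nat \<Rightarrow> nat) \<Rightarrow> nat \<Rightarrow> nat \<Rightarrow> 'a" where
  "veps v \<epsilon> = (\<lambda>i. if \<epsilon> i = 0 then stdvec i else v i)"

definition wvec :: "nat \<Rightarrow> (nat \<Rightarrow> nat \<Rightarrow> 'a::field) \<Rightarrow> nat \<Rightarrow> 'a" where
  "wvec n u = (THE w. w \<in> orth n (vct.span (u ` {1..n-1})) \<and> dotp n w (stdvec n) = 1)"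

fun theta :: "nat \<Rightarrow> (nat \<Rightarrow> nat \<Rightarrow> 'a::field) \<Rightarrow> kvertex \<Rightarrow> nat \<Rightarrow> 'a" where
  "theta n v (KA i k) = (if k = 0 then stdvec i else v i)"
| "theta n v KB = stdvec n"

definition fmap :: "nat \<Rightarrow> (nat \<Rightarrow> nat \<Rightarrow> 'a::field) \<Rightarrow> kvertex set \<Rightarrow> (nat \<Rightarrow> 'a) set" where
  "fmap n v \<sigma> = orth n (vct.span (theta n v ` \<sigma>))"

definition hsys :: "nat \<Rightarrow> (nat \<Rightarrow> nat \<Rightarrow> 'a::field) \<Rightarrow> (kvertex set, nat \<Rightarrow> 'a) local_sys" where
  "hsys n v = pullback (fmap n v) (gsys n)"

text \<open>
  The flag \<open>F\<close> determines \<open>\<epsilon>\<close>, \<open>\<pi>\<close> and \<open>j\<close>, so that the descriptions below are unique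
  (\<open>ccyc_a\<close>, \<open>ccyc_b\<close>).
\<close>

definition ccyc :: "nat \<Rightarrow> (nat \<Rightarrow> nat \<Rightarrow> 'a::field) \<Rightarrow> kvertex set set \<Rightarrow> nat \<Rightarrow> 'a" where
  "ccyc n v F =
     (if \<exists>\<epsilon>\<in>Eset n. \<exists>\<pi>. \<pi> permutes {1..n-1} \<and> F = Sflag n (avec \<epsilon> \<circ> \<pi>)
      then THE m. \<exists>\<epsilon>\<in>Eset n. \<exists>\<pi>. \<pi> permutes {1..n-1} \<and> F = Sflag n (avec \<epsilon> \<circ> \<pi>) \<and>
             m = vscale (of_int (chi n \<epsilon> \<pi>)) (wvec n (veps v \<epsilon>))
      else if \<exists>j\<in>{1..n-1}. \<exists>\<epsilon>\<in>Eset0 n j. \<exists>\<pi>. \<pi> permutes {1..n-1} \<and> F = Sflag n (avecb \<epsilon> j \<circ> \<pi>)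
      then THE m. \<exists>j\<in>{1..n-1}. \<exists>\<epsilon>\<in>Eset0 n j. \<exists>\<pi>. \<pi> permutes {1..n-1} \<and>
             F = Sflag n (avecb \<epsilon> j \<circ> \<pi>) \<and>
             m = vscale (of_int (chi n \<epsilon> \<pi>)) (wvec n (veps v (\<epsilon>(j := 1))) - wvec n (veps v \<epsilon>))
      else 0)"

definition ctilde :: "nat \<Rightarrow> (nat \<Rightarrow> nat \<Rightarrow> 'a::field) \<Rightarrow> (nat \<Rightarrow> 'a) set set \<Rightarrow> nat \<Rightarrow> 'a" where
  "ctilde n v = push_forward (fmap n v) (sd (Kcx n)) (int n - 2) (ccyc n v)"


section \<open>Well-definedness\<close>

lemma Sflag_inj:
  assumes x: "inj_on x {1..n-1}" and y: "inj_on y {1..n-1}"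
    and eq: "Sflag n x = Sflag n y" and i: "i \<in> {1..n-1}"
  shows "x i = y i"
proof -
  have img: "x ` {1..k} = y ` {1..k}" if k: "k \<in> {1..n-1}" for k
  proof -
    have "x ` {1..k} \<in> Sflag n x" unfolding Sflag_def using k by blast
    then have "x ` {1..k} \<in> Sflag n y" using eq by simp
    then obtain l where l: "l \<in> {1..n-1}" "x ` {1..k} = y ` {1..l}" by (auto simp: Sflag_def)
    have "inj_on x {1..k}" "inj_on y {1..l}"
      using k l by (auto intro: inj_on_subset[OF x] inj_on_subset[OF y])
    then have "card (x ` {1..k}) = k" "card (y ` {1..l}) = l"
      by (simp_all add: card_image)
    then show ?thesis using l by simp
  qed
  have *: "z ` {1..i} - z ` {1..i-1} = {z i}" if z: "inj_on z {1..n-1}" for z :: "nat \<Rightarrow> 'a"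
  proof -
    have "z ` {1..i} - z ` {1..i-1} = z ` ({1..i} - {1..i-1})"
      using i z by (subst inj_on_image_set_diff[of z "{1..n-1}"]) auto
    also have "{1..i} - {1..i-1} = {i}" using i by auto
    finally show ?thesis by simp
  qed
  have "x ` {1..i-1} = y ` {1..i-1}"
  proof (cases "i = 1")
    case False
    then have "i - 1 \<in> {1..n-1}" using i by auto
    then show ?thesis by (rule img)
  qed simp
  then show ?thesis using *[OF x] *[OF y] img[OF i] by auto
qed

lemma inj_avec: "inj_on (avec \<epsilon>) I" and inj_avecb: "inj_on (avecb \<epsilon> j) I"
  by (auto simp: avec_def avecb_def inj_on_def)

lemma inj_comp_perm:
  assumes "inj z" "\<pi> permutes I" shows "inj_on (z \<circ> \<pi>) J"
  using assms by (metis comp_inj_on inj_on_subset permutes_inj subset_UNIV)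

lemma avec_flag_unique:
  assumes "\<epsilon> \<in> Eset n" "\<epsilon>' \<in> Eset n" "\<pi> permutes {1..n-1}" "\<pi>' permutes {1..n-1}"
    and "Sflag n (avec \<epsilon> \<circ> \<pi>) = Sflag n (avec \<epsilon>' \<circ> \<pi>')"
  shows "\<epsilon> = \<epsilon>' \<and> \<pi> = \<pi>'"
proof -
  have eq: "avec \<epsilon> (\<pi> i) = avec \<epsilon>' (\<pi>' i)" if "i \<in> {1..n-1}" for i
    using Sflag_inj[OF inj_comp_perm[OF inj_avec assms(3)] inj_comp_perm[OF inj_avec assms(4)] assms(5) that]
    by simp
  have p: "\<pi> = \<pi>'"
  proof
    fix i show "\<pi> i = \<pi>' i"
      using eq[of i] assms(3,4) by (cases "i \<in> {1..n-1}") (auto simp: avec_def permutes_not_in)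
  qed
  have "\<epsilon> k = \<epsilon>' k" if "k \<in> {1..n-1}" for k
  proof -
    have "k \<in> \<pi> ` {1..n-1}" using that permutes_image[OF assms(3)] by simp
    then obtain i where "i \<in> {1..n-1}" "k = \<pi> i" by (rule imageE)
    then show ?thesis using eq[of i] p by (auto simp: avec_def)
  qed
  then have "\<epsilon> = \<epsilon>'" using assms(1,2) unfolding Eset_def by (intro PiE_ext)
  then show ?thesis using p by simp
qed

lemma avecb_flag_unique:
  assumes "j \<in> {1..n-1}" "j' \<in> {1..n-1}" "\<epsilon> \<in> Eset0 n j" "\<epsilon>' \<in> Eset0 n j'"
    and "\<pi> permutes {1..n-1}" "\<pi>' permutes {1..n-1}"
    and "Sflag n (avecb \<epsilon> j \<circ> \<pi>) = Sflag n (avecb \<epsilon>' j' \<circ> \<pi>')"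
  shows "j = j' \<and> \<epsilon> = \<epsilon>' \<and> \<pi> = \<pi>'"
proof -
  have eq: "avecb \<epsilon> j (\<pi> i) = avecb \<epsilon>' j' (\<pi>' i)" if "i \<in> {1..n-1}" for i
    using Sflag_inj[OF inj_comp_perm[OF inj_avecb assms(5)] inj_comp_perm[OF inj_avecb assms(6)] assms(7) that]
    by simp
  have im: "\<pi> ` {1..n-1} = {1..n-1}" "\<pi>' ` {1..n-1} = {1..n-1}"
    using assms(5,6) by (auto simp: permutes_image)
  have "avecb \<epsilon> j ` {1..n-1} = avecb \<epsilon>' j' ` {1..n-1}"
    using eq im by (metis (no_types, lifting) image_cong image_image)
  then have img: "avecb \<epsilon> j k \<in> avecb \<epsilon>' j' ` {1..n-1}" if "k \<in> {1..n-1}" for k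
    using that by blast
  have jj: "j = j'"
  proof (rule ccontr)
    assume "j \<noteq> j'"
    then show False using img[of j'] assms(2)
      by (auto simp: avecb_def avec_def split: if_splits)
  qed
  have p: "\<pi> = \<pi>'"
  proof
    fix i show "\<pi> i = \<pi>' i"
      using eq[of i] jj assms(5,6)
      by (cases "i \<in> {1..n-1}") (auto simp: avecb_def avec_def permutes_not_in split: if_splits)
  qed
  have "\<epsilon> k = \<epsilon>' k" if "k \<in> {1..n-1}" for k
  proof (cases "k = j")
    case True
    then show ?thesis using assms(3,4) jj by (auto simp: Eset0_def)
  next
    case False
    have "k \<in> \<pi> ` {1..n-1}" using that im by simp
    then obtain i where "i \<in> {1..n-1}" "k = \<pi> i" by (rule imageE)
    then show ?thesis using eq[of i] p jj False by (auto simp: avecb_def avec_def)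
  qed
  then have "\<epsilon> = \<epsilon>'"
    using assms(3,4) unfolding Eset0_def Eset_def by (intro PiE_ext[of \<epsilon> "{1..n-1}" _ \<epsilon>']) auto
  then show ?thesis using p jj by simp
qed

lemma Sflag_Union: "n \<ge> 2 \<Longrightarrow> \<Union>(Sflag n x) = x ` {1..n-1}"
proof -
  assume "n \<ge> 2"
  then have "x ` {1..n-1} \<in> Sflag n x" unfolding Sflag_def by force
  moreover have "F \<subseteq> x ` {1..n-1}" if "F \<in> Sflag n x" for F
    using that by (auto simp: Sflag_def)
  ultimately show ?thesis by blast
qed

lemma avec_avecb_flag:
  assumes "j \<in> {1..n-1}" "\<pi> permutes {1..n-1}" "\<pi>' permutes {1..n-1}"
  shows "Sflag n (avec \<epsilon> \<circ> \<pi>) \<noteq> Sflag n (avecb \<epsilon>' j \<circ> \<pi>')"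
proof
  assume eq: "Sflag n (avec \<epsilon> \<circ> \<pi>) = Sflag n (avecb \<epsilon>' j \<circ> \<pi>')"
  have n: "n \<ge> 2" using assms(1) by auto
  have "KB \<in> avecb \<epsilon>' j ` {1..n-1}" using assms(1) by (force simp: avecb_def)
  also have "\<dots> = (avecb \<epsilon>' j \<circ> \<pi>') ` {1..n-1}" 
    using permutes_image[OF assms(3)] by (metis image_comp)
  also have "\<dots> = (avec \<epsilon> \<circ> \<pi>) ` {1..n-1}" using eq Sflag_Union[OF n] by metis
  finally show False by (auto simp: avec_def)
qed

lemma ccyc_a:
  assumes "\<epsilon> \<in> Eset n" "\<pi> permutes {1..n-1}"
  shows "ccyc n v (Sflag n (avec \<epsilon> \<circ> \<pi>)) = vscale (of_int (chi n \<epsilon> \<pi>)) (wvec n (veps v \<epsilon>))"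
proof -
  have "(THE m. \<exists>\<epsilon>'\<in>Eset n. \<exists>\<pi>'. \<pi>' permutes {1..n-1} \<and> Sflag n (avec \<epsilon> \<circ> \<pi>) = Sflag n (avec \<epsilon>' \<circ> \<pi>') \<and>
             m = vscale (of_int (chi n \<epsilon>' \<pi>')) (wvec n (veps v \<epsilon>')))
        = vscale (of_int (chi n \<epsilon> \<pi>)) (wvec n (veps v \<epsilon>))"
    using assms avec_flag_unique[OF assms(1) _ assms(2)] by (intro the_equality) blast+
  then show ?thesis using assms unfolding ccyc_def by auto
qed

lemma ccyc_b:
  assumes j: "j \<in> {1..n-1}" and e: "\<epsilon> \<in> Eset0 n j" and p: "\<pi> permutes {1..n-1}"
  shows "ccyc n v (Sflag n (avecb \<epsilon> j \<circ> \<pi>)) =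
           vscale (of_int (chi n \<epsilon> \<pi>)) (wvec n (veps v (\<epsilon>(j := 1))) - wvec n (veps v \<epsilon>))"
proof -
  have "(THE m. \<exists>j'\<in>{1..n-1}. \<exists>\<epsilon>'\<in>Eset0 n j'. \<exists>\<pi>'. \<pi>' permutes {1..n-1} \<and>
             Sflag n (avecb \<epsilon> j \<circ> \<pi>) = Sflag n (avecb \<epsilon>' j' \<circ> \<pi>') \<and>
             m = vscale (of_int (chi n \<epsilon>' \<pi>')) (wvec n (veps v (\<epsilon>'(j' := 1))) - wvec n (veps v \<epsilon>')))
        = vscale (of_int (chi n \<epsilon> \<pi>)) (wvec n (veps v (\<epsilon>(j := 1))) - wvec n (veps v \<epsilon>))"
    using assms avecb_flag_unique[OF j _ e _ p] by (intro the_equality) blast+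
  moreover have "\<not> (\<exists>\<epsilon>'\<in>Eset n. \<exists>\<pi>'. \<pi>' permutes {1..n-1} \<and> Sflag n (avecb \<epsilon> j \<circ> \<pi>) = Sflag n (avec \<epsilon>' \<circ> \<pi>'))"
    using avec_avecb_flag[OF j _ p] by metis
  moreover have "\<exists>j'\<in>{1..n-1}. \<exists>\<epsilon>'\<in>Eset0 n j'. \<exists>\<pi>'. \<pi>' permutes {1..n-1} \<and>
             Sflag n (avecb \<epsilon> j \<circ> \<pi>) = Sflag n (avecb \<epsilon>' j' \<circ> \<pi>')"
    using assms by blast
  ultimately show ?thesis unfolding ccyc_def by (simp only: if_True if_False)
qed

lemma Vsp_span: "Vsp n \<subseteq> vct.span (stdvec ` {1..n})"
proof
  fix u :: "nat \<Rightarrow> 'a" assume u: "u \<in> Vsp n"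
  have "(\<Sum>i\<in>{1..n}. vscale (u i) (stdvec i)) j = u j" for j
  proof -
    have "(\<Sum>i\<in>I. vscale (u i) (stdvec i)) j = (\<Sum>i\<in>I. vscale (u i) (stdvec i) j)" if "finite I" for I
      using that by induction auto
    then have "(\<Sum>i\<in>{1..n}. vscale (u i) (stdvec i)) j = (\<Sum>i\<in>{1..n}. if j = i then u i else 0)"
      by (simp add: vscale_def stdvec_def if_distrib cong: if_cong)
    then show ?thesis using u by (auto simp: Vsp_def)
  qed
  then have "u = (\<Sum>i\<in>{1..n}. vscale (u i) (stdvec i))" by (auto simp: fun_eq_iff)
  also have "\<dots> \<in> vct.span (stdvec ` {1..n})"
    by (intro vct.span_sum vct.span_scale vct.span_base) auto
  finally show "u \<in> vct.span (stdvec ` {1..n})" .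
qed

lemma indep_Vsp_card:
  assumes "vct.independent S" "S \<subseteq> (Vsp n :: (nat \<Rightarrow> 'a::field) set)"
  shows "finite S \<and> card S \<le> n"
proof -
  have "finite S \<and> card S \<le> card (stdvec ` {1..n} :: (nat \<Rightarrow> 'a) set)"
    using assms Vsp_span by (intro vct.independent_span_bound) auto
  moreover have "card (stdvec ` {1..n} :: (nat \<Rightarrow> 'a) set) \<le> n"
    using card_image_le[of "{1..n}" "stdvec :: nat \<Rightarrow> nat \<Rightarrow> 'a"] by simp
  ultimately show ?thesis by linarith
qed

lemma subspace_Vsp: "vct.subspace (Vsp n)"
  by (auto simp: vct.subspace_def Vsp_def vscale_def)

lemma dim_Vsp_le: "S \<subseteq> Vsp n \<Longrightarrow> vct.dim S \<le> n"
  by (metis indep_Vsp_card subset_trans vct.basis_exists)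

lemma dim_strict_mono:
  assumes "vct.subspace U" "vct.subspace W" "U \<subset> W" "W \<subseteq> Vsp n"
  shows "vct.dim U < vct.dim W"
proof -
  obtain S where S: "S \<subseteq> U" "vct.independent S" "U \<subseteq> vct.span S" "card S = vct.dim U"
    using vct.basis_exists by blast
  obtain S' where S': "S \<subseteq> S'" "S' \<subseteq> W" "vct.independent S'" "W \<subseteq> vct.span S'"
    using vct.maximal_independent_subset_extend[of S W] S assms by blast
  have fin: "finite S'" using indep_Vsp_card S' assms(4) by blast
  have "S \<noteq> S'" using S S' assms(1,3) vct.span_minimal by blast
  then have "card S < card S'" using S' fin by (simp add: psubset_card_mono psubset_eq)
  moreover have "card S' = vct.dim W" using vct.basis_card_eq_dim S' by blast
  ultimately show ?thesis using S by simp
qed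

lemma XV_card: 
  assumes "n \<ge> 1" "\<sigma> \<in> (XV n :: (nat \<Rightarrow> 'a::field) set set set)" shows "card \<sigma> \<le> n - 1"
proof -
  have fin: "finite \<sigma>" and ch: "chain\<^sub>\<subseteq> \<sigma>"
    and sub: "\<And>U. U \<in> \<sigma> \<Longrightarrow> vct.subspace U \<and> U \<noteq> {0} \<and> U \<subset> Vsp n"
    using assms(2) by (auto simp: XV_def flag_complex_def)
  have lt: "vct.dim U < vct.dim W" if "U \<in> \<sigma>" "W \<in> \<sigma>" "U \<subset> W" for U W
    using that sub[of U] sub[of W] by (intro dim_strict_mono) auto
  have "inj_on vct.dim \<sigma>"
  proof (rule inj_onI)
    fix U W assume "U \<in> \<sigma>" "W \<in> \<sigma>" "vct.dim U = vct.dim W"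
    then have "\<not> U \<subset> W" "\<not> W \<subset> U" "U \<subseteq> W \<or> W \<subseteq> U"
      using ch lt[of U W] lt[of W U] by (auto simp: chain_subset_def)
    then show "U = W" by blast
  qed
  moreover have "vct.dim ` \<sigma> \<subseteq> {1..n-1}"
  proof
    fix d assume "d \<in> vct.dim ` \<sigma>"
    then obtain U where U: "U \<in> \<sigma>" "d = vct.dim U" by blast
    have "vct.dim {0::nat \<Rightarrow> 'a} < vct.dim U"
      using sub[OF U(1)] vct.subspace_0[of U] by (intro dim_strict_mono[of _ _ n]) (auto simp: vct.subspace_single_0)
    moreover have "vct.dim U < vct.dim (Vsp n :: (nat \<Rightarrow> 'a) set)"
      using sub[OF U(1)] subspace_Vsp by (intro dim_strict_mono[of _ _ n]) auto
    moreover have "vct.dim (Vsp n :: (nat \<Rightarrow> 'a) set) \<le> n" by (intro dim_Vsp_le) auto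
    ultimately show "d \<in> {1..n-1}" using U by auto
  qed
  ultimately have "card \<sigma> \<le> card {1..n-1}" by (metis card_inj_on_le finite_atLeastAtMost)
  then show ?thesis by simp
qed

lemma boundary_group_XV:
  assumes "n \<ge> 2"
  shows "boundary_group dim_prec (XV n) (gsys n) (int n - 2) = {0}"
proof -
  have "simplices (XV n :: (nat \<Rightarrow> 'a) set set set) (int n - 1) = {}"
    using XV_card[of n] assms by (force simp: simplices_def)
  then show ?thesis by (auto simp: boundary_group_def boundary_def chain_group_def)
qed

lemma flag_Inter_in:
  assumes "finite C" "C \<noteq> {}" "chain\<^sub>\<subseteq> C" shows "\<Inter>C \<in> C"
  using assms
proof (induction C rule: finite_ne_induct)
  case (insert U C)
  then have "\<Inter>C \<in> C" by (auto simp: chain_subset_def)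
  then have "U \<subseteq> \<Inter>C \<or> \<Inter>C \<subseteq> U" using insert.prems unfolding chain_subset_def by blast
  then have "U \<inter> \<Inter>C = U \<or> U \<inter> \<Inter>C = \<Inter>C" by blast
  then show ?case using \<open>\<Inter>C \<in> C\<close> by auto
qed simp

lemma push_forward_in_chain_group:
  fixes L :: "('w, 'm::ab_group_add) local_sys" and f :: "'v \<Rightarrow> 'w"
  assumes L: "local_system Y L" and c: "c \<in> chain_group X (pullback f L) p"
    and f: "\<And>\<sigma>. \<sigma> \<in> simplices X p \<Longrightarrow> f ` \<sigma> \<in> simplices Y p"
  shows "push_forward f X p c \<in> chain_group Y L p"
proof -
  have sum_apply: "(\<Sum>i\<in>I. g i) t = (\<Sum>i\<in>I. g i t)"
    for I :: "'v set set" and g :: "'v set \<Rightarrow> 'w set \<Rightarrow> 'm" and t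
    by (induction I rule: infinite_finite_induct) auto
  have "(\<Sum>\<sigma>\<in>I. single (f ` \<sigma>) (c \<sigma>) \<tau>) \<in> stalk L \<tau>"
    if "\<tau> \<in> simplices Y p" "I \<subseteq> simplices X p" for I \<tau>
    using that(2)
  proof (induction I rule: infinite_finite_induct)
    case (insert \<sigma> I)
    have "c \<sigma> \<in> stalk L (f ` \<sigma>)"
      using insert.prems c by (auto simp: chain_group_def pullback_def)
    then have "single (f ` \<sigma>) (c \<sigma>) \<tau> \<in> stalk L \<tau>"
      using that(1) L by (auto simp: single_def local_system_def simplices_def)
    then show ?case using insert L that(1) by (simp add: local_system_def simplices_def)
  qed (use L that(1) in \<open>auto simp: local_system_def simplices_def\<close>)
  moreover have "single (f ` \<sigma>) (c \<sigma>) \<tau> = 0" if "\<sigma> \<in> simplices X p" "\<tau> \<notin> simplices Y p" for \<sigma> \<tau>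
    using f[OF that(1)] that(2) by (auto simp: single_def)
  ultimately show ?thesis
    unfolding chain_group_def push_forward_def by (auto simp: sum_apply intro!: sum.neutral)
qed

lemma local_system_gsys: "local_system (XV n) (gsys n)"
proof -
  have sub: "vct.subspace (stalk (gsys n) \<sigma>)" if "\<sigma> \<in> XV n" for \<sigma> :: "(nat \<Rightarrow> 'a) set set"
    using that flag_Inter_in[of \<sigma>] subspace_Vsp by (auto simp: gsys_def XV_def flag_complex_def)
  have mono: "stalk (gsys n) \<tau> \<subseteq> stalk (gsys n) \<sigma>" if "\<tau> \<in> XV n" "\<sigma> \<subseteq> \<tau>" for \<sigma> \<tau> :: "(nat \<Rightarrow> 'a) set set"
  proof (cases "\<tau> = {}")
    case False
    then have "\<Inter>\<tau> \<in> \<tau>" using that flag_Inter_in[of \<tau>] by (auto simp: XV_def flag_complex_def)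
    then have "\<Inter>\<tau> \<subseteq> Vsp n" using that by (auto simp: XV_def flag_complex_def)
    then show ?thesis using that False by (auto simp: gsys_def)
  qed (use that in auto)
  have r: "restr (gsys n) \<sigma> \<tau> x = x" for \<sigma> \<tau> :: "(nat \<Rightarrow> 'a) set set" and x
    by (simp add: gsys_def)
  show ?thesis unfolding local_system_def r
    by (intro conjI ballI impI allI refl)
      (auto intro: vct.subspace_0[OF sub] vct.subspace_add[OF sub] vct.subspace_neg[OF sub]
        subsetD[OF mono])
qed

end

theory Submission
  imports Defs
begin

text \<open>
  Write \<open>c\<close> for the class attached to \<open>v\<close>. Splitting the coefficients \<open>w(v\<^sup>\<epsilon>\<^sup>+\<^sup>e\<^sup>j) - w(v\<^sup>\<epsilon>)\<close> shows that \<open>c\<close> is the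
  alternating sum over \<open>\<epsilon>\<close> of \<open>w(v\<^sup>\<epsilon>)\<close> times the apartment of the basis \<open>(v\<^sup>\<epsilon>, e\<^sub>n)\<close>; since apartments
  are cycles, so is \<open>c\<close>. By triangularity the flag of the orthogonal complements of
  \<open>\<langle>v\<^sub>1, \<dots>, v\<^sub>k\<rangle>\<close> lies in the support of the class of \<open>v\<close> and of no other class. Hence it suffices
  that a cycle vanishing on all these flags is zero. Flags are shown to have coefficient zero by
  downward induction on the number \<open>k\<close> of vectors \<open>v\<^sub>1, \<dots>, v\<^sub>k\<close> describing their top members: each
  cycle relation sums over the subspaces between two members of a flag, and those of the relations
  which contain only one unknown term (or, for the least member of the flag, two unknown terms in
  complementary subspaces) propagate the vanishing.
\<close>

text \<open>A single apartment with coefficient \<open>w(v^\<epsilon>)\<close> is not a chain of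
  \<open>gsys\<close>: where \<open>e_n\<close> is among the vectors defining the least member, that
  member does not contain \<open>w(v^\<epsilon>)\<close>. As the connecting maps are inclusions, the
  boundary formula still makes sense for arbitrary vector-valued functions. So the apartment form
  gives the vanishing boundary, and the grouped form gives coefficients in the stalks. At a dual
  flag the stalk is a line on which coordinate \<open>n\<close> is injective. This coordinate turns
  the evaluation of the classes into a scalar matrix, diagonal with entries 1 or -1. For spanning,
  the obstacle is the condition \<open>v_k \<noteq> e_k\<close>. In
  \<open>W = <v_1, ..., v_{k-1}>^perp\<close>, the hyperplanes missing a certain vector
  \<open>d\<close> correspond to the vectors of \<open>e_k + <e_{k+1}, ..., e_n>\<close>, and
  \<open>e_k\<close> itself gives the hyperplane where coordinate \<open>k\<close> is 0. Thus two
  kinds of hyperplane carry no index: those through \<open>d\<close> and this exceptional one. The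
  relations couple both kinds, and they separate only at the bottom of the flag, where coefficients
  lie in the least member.\<close>

lemma sum_fun_apply: "(\<Sum>i\<in>I. g i) t = (\<Sum>i\<in>I. g i t)"
  for g :: "'i \<Rightarrow> 's \<Rightarrow> 'm::comm_monoid_add"
  by (induction I rule: infinite_finite_induct) auto

section \<open>Unitriangular families\<close>

lemma dotp_add_left: "dotp n (u + u') x = dotp n u x + dotp n u' x"
  and dotp_diff_left: "dotp n (u - u') x = dotp n u x - dotp n u' x"
  and dotp_scale_left: "dotp n (vscale t u) x = t * dotp n u x"
  and dotp_add_right: "dotp n u (x + x') = dotp n u x + dotp n u x'"
  and dotp_scale_right: "dotp n u (vscale t x) = t * dotp n u x"
  and dotp_zero_left: "dotp n 0 x = 0"
  by (simp_all add: dotp_def vscale_def algebra_simps sum.distrib sum_distrib_left sum_subtractf)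

lemma dotp_stdvec_right: "i \<in> {1..n} \<Longrightarrow> dotp n u (stdvec i) = u i"
  and dotp_stdvec_left: "i \<in> {1..n} \<Longrightarrow> dotp n (stdvec i) u = u i"
  by (simp_all add: dotp_def stdvec_def if_distrib if_distribR cong: if_cong)

lemma stdvec_in_Vsp: "i \<in> {1..n} \<Longrightarrow> stdvec i \<in> Vsp n"
  by (auto simp: Vsp_def stdvec_def)

lemma finite_Vsp: "finite (Vsp n :: (nat \<Rightarrow> 'a::{field, finite}) set)"
proof -
  have "Vsp n = {f :: nat \<Rightarrow> 'a. \<forall>x. (x \<in> {1..n} \<longrightarrow> f x \<in> UNIV) \<and> (x \<notin> {1..n} \<longrightarrow> f x = 0)}"
    by (auto simp: Vsp_def)
  also have "finite \<dots>" by (rule finite_set_of_finite_funs) auto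
  finally show ?thesis .
qed

lemma orth_span: "orth n (vct.span A) = orth n A"
proof
  show "orth n (vct.span A) \<subseteq> orth n A"
    using vct.span_base by (auto simp: orth_def)
  show "orth n A \<subseteq> orth n (vct.span A)"
  proof
    fix u assume u: "u \<in> orth n A"
    have "dotp n u x = 0" if "x \<in> vct.span A" for x
      using that
    proof (induction rule: vct.span_induct_alt)
      case (step c x y)
      then show ?case using u unfolding dotp_add_right dotp_scale_right by (simp add: orth_def)
    qed (simp add: dotp_def)
    then show "u \<in> orth n (vct.span A)" using u by (simp add: orth_def)
  qed
qed

lemma subspace_orth: "vct.subspace (orth n A)"
  using subspace_Vsp
  by (auto simp: vct.subspace_def orth_def dotp_add_left dotp_scale_left dotp_zero_left)

lemma orth_subset_Vsp: "orth n A \<subseteq> Vsp n"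
  by (auto simp: orth_def)

definition unitriangular :: "nat \<Rightarrow> (nat \<Rightarrow> nat \<Rightarrow> 'a::field) \<Rightarrow> bool" where
  "unitriangular n y \<longleftrightarrow> (\<forall>i\<in>{1..n}. y i \<in> Vsp n \<and> y i i = 1 \<and> (\<forall>j<i. y i j = 0))"

text \<open>Back substitution from the last equation: adding a multiple of \<open>stdvec r\<close>
  corrects equation \<open>r\<close>, where \<open>y r r = 1\<close>, and leaves the equations
  \<open>i > r\<close> alone, since \<open>y i r = 0\<close>.\<close>

lemma unitriangular_solve:
  assumes y: "unitriangular n y"
  obtains u where "u \<in> Vsp n" "\<And>i. i \<in> {1..n} \<Longrightarrow> dotp n u (y i) = b i"
proof -
  have "\<exists>u\<in>Vsp n. \<forall>i\<in>{n-m+1..n}. dotp n u (y i) = b i" if "m \<le> n" for m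
    using that
  proof (induction m)
    case 0
    then show ?case using vct.subspace_0[OF subspace_Vsp] by auto
  next
    case (Suc m)
    then obtain u where u: "u \<in> Vsp n" "\<And>i. i \<in> {n-m+1..n} \<Longrightarrow> dotp n u (y i) = b i" by auto
    define r where "r = n - m"
    have r: "r \<in> {1..n}" "n - Suc m + 1 = r" using Suc.prems by (auto simp: r_def)
    let ?u = "u + vscale (b r - dotp n u (y r)) (stdvec r)"
    have "?u \<in> Vsp n"
      using u r by (intro vct.subspace_add vct.subspace_scale subspace_Vsp stdvec_in_Vsp) auto
    moreover have "dotp n ?u (y i) = b i" if "i \<in> {r..n}" for i
      using that y u(2)[of i] r
      by (cases "i = r") (auto simp: dotp_add_left dotp_scale_left dotp_stdvec_left unitriangular_def r_def)
    ultimately show ?case unfolding r(2) by blast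
  qed
  from this[of n] show ?thesis using that by auto
qed

text \<open>In equation \<open>j\<close> the terms below \<open>j\<close> vanish by triangularity
  and those above \<open>j\<close> by induction, which leaves \<open>u j\<close>.\<close>

lemma unitriangular_unique:
  assumes y: "unitriangular n y" and u: "u \<in> Vsp n" "\<And>i. i \<in> {1..n} \<Longrightarrow> dotp n u (y i) = 0"
  shows "u = 0"
proof -
  have "u j = 0" if "j \<in> {1..n}" for j
    using that
  proof (induction "n - j" arbitrary: j rule: less_induct)
    case less
    have "u i * y j i = (if i = j then u j else 0)" if "i \<in> {1..n}" for i
    proof (cases i j rule: linorder_cases)
      case greater
      then have "u i = 0" using that less.prems by (intro less.hyps) auto
      then show ?thesis using greater by simp
    qed (use y less.prems in \<open>auto simp: unitriangular_def\<close>)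
    then have "dotp n u (y j) = (\<Sum>i\<in>{1..n}. if i = j then u j else 0)"
      unfolding dotp_def by (intro sum.cong) auto
    then show ?case using u(2)[OF less.prems] less.prems by simp
  qed
  then show ?thesis using u(1) by (auto simp: Vsp_def fun_eq_iff)
qed

section \<open>Full flags\<close>

text \<open>Indexed by dimension. The trivial ends \<open>U 0\<close> and \<open>U n\<close> are
  included so that the least and the greatest proper member also have two neighbours. Values beyond
  \<open>n\<close> are arbitrary.\<close>

definition full_flag :: "nat \<Rightarrow> (nat \<Rightarrow> (nat \<Rightarrow> 'a::field) set) \<Rightarrow> bool" where
  "full_flag n U \<longleftrightarrow> (\<forall>i\<le>n. vct.subspace (U i)) \<and> U 0 = {0} \<and> U n = Vsp n \<and> (\<forall>i<n. U i \<subset> U (Suc i))"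

lemma full_flagD:
  assumes "full_flag n U"
  shows full_flag_subspace: "i \<le> n \<Longrightarrow> vct.subspace (U i)"
    and full_flag_0: "U 0 = {0}" and full_flag_top: "U n = Vsp n"
    and full_flag_Suc: "i < n \<Longrightarrow> U i \<subset> U (Suc i)"
  using assms by (auto simp: full_flag_def)

lemma full_flag_mono:
  assumes "full_flag n U" "i \<le> j" "j \<le> n"
  shows "U i \<subseteq> U j"
  using assms(2,3)
proof (induction j rule: dec_induct)
  case (step j)
  then show ?case using full_flag_Suc[OF assms(1), of j] by auto
qed simp

lemma full_flag_strict_mono:
  assumes "full_flag n U" "i < j" "j \<le> n"
  shows "U i \<subset> U j"
  using full_flag_Suc[OF assms(1), of i] full_flag_mono[OF assms(1), of "Suc i" j] assms by auto

lemma full_flag_subset_Vsp: "full_flag n U \<Longrightarrow> i \<le> n \<Longrightarrow> U i \<subseteq> Vsp n"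
  using full_flag_mono[of n U i n] by (simp add: full_flag_top)

text \<open>Strict inclusions give \<open>dim (U i) \<ge> i\<close> when counted up from 0, and
  \<open>dim (U i) \<le> i\<close> when counted down from \<open>dim V \<le> n\<close>.\<close>

lemma full_flag_dim:
  assumes U: "full_flag n U" and i: "i \<le> n"
  shows "vct.dim (U i) = i"
proof -
  have lt: "vct.dim (U i) < vct.dim (U (Suc i))" if "i < n" for i
    using that U full_flag_subset_Vsp[OF U, of "Suc i"]
    by (intro dim_strict_mono) (auto simp: full_flag_def)
  have "i \<le> vct.dim (U i)" if "i \<le> n" for i
    using that
  proof (induction i)
    case (Suc i)
    then show ?case using lt[of i] by simp
  qed simp
  moreover have "vct.dim (U (n - m)) \<le> n - m" if "m \<le> n" for m
    using that
  proof (induction m)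
    case 0
    then show ?case using U dim_Vsp_le[of "U n" n] by (simp add: full_flag_top)
  next
    case (Suc m)
    then show ?case using lt[of "n - Suc m"] by (simp add: Suc_diff_Suc)
  qed
  from this[of "n - i"] have "vct.dim (U i) \<le> i" using i by simp
  ultimately show ?thesis using i by (simp add: le_antisym)
qed

lemma full_flag_no_between:
  assumes U: "full_flag n U" and i: "i < n" and A: "vct.subspace A" "U i \<subset> A" "A \<subseteq> U (Suc i)"
  shows "A = U (Suc i)"
proof (rule ccontr)
  assume "A \<noteq> U (Suc i)"
  then have "vct.dim A < vct.dim (U (Suc i))"
    using A i U full_flag_subset_Vsp[OF U, of "Suc i"]
    by (intro dim_strict_mono) (auto simp: full_flag_subspace)
  moreover have "vct.dim (U i) < vct.dim A"
    using A i U full_flag_subset_Vsp[OF U, of "Suc i"]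
    by (intro dim_strict_mono) (auto simp: full_flag_subspace)
  ultimately show False using full_flag_dim[OF U] i by simp
qed

definition between :: "(nat \<Rightarrow> 'a::field) set \<Rightarrow> (nat \<Rightarrow> 'a) set \<Rightarrow> (nat \<Rightarrow> 'a) set set" where
  "between A B = {M. vct.subspace M \<and> A \<subset> M \<and> M \<subset> B}"

lemma full_flag_update:
  assumes U: "full_flag n U" and i: "0 < i" "i < n" and M: "M \<in> between (U (i - 1)) (U (Suc i))"
  shows "full_flag n (U(i := M))"
  unfolding full_flag_def
proof (intro conjI allI impI)
  fix j assume "j < n"
  then consider "j = i" | "Suc j = i" | "j \<noteq> i" "Suc j \<noteq> i" by blast
  then show "(U(i := M)) j \<subset> (U(i := M)) (Suc j)"
    using M full_flag_Suc[OF U \<open>j < n\<close>] by cases (auto simp: between_def)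
qed (use assms in \<open>simp_all add: full_flag_def between_def\<close>)

lemma full_flag_in_between:
  assumes "full_flag n U" "0 < i" "i < n"
  shows "U i \<in> between (U (i - 1)) (U (Suc i))"
  using full_flag_Suc[OF assms(1), of i] full_flag_Suc[OF assms(1), of "i - 1"]
    full_flag_subspace[OF assms(1), of i] assms(2,3) by (simp add: between_def)

lemma full_flag_inj: "full_flag n U \<Longrightarrow> inj_on U {0..n}"
  by (rule inj_on_inverseI[where g = vct.dim]) (simp add: full_flag_dim)

lemma full_flag_simplex:
  assumes U: "full_flag n U" and n: "n \<ge> 2"
  shows "U ` {1..n-1} \<in> simplices (XV n) (int n - 2)"
proof -
  have "inj_on U {1..n-1}" using full_flag_inj[OF U] by (rule inj_on_subset) auto
  then have "card (U ` {1..n-1}) = n - 1" by (simp add: card_image)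
  moreover have "chain\<^sub>\<subseteq> (U ` {1..n-1})"
    unfolding chain_subset_def
  proof (intro ballI)
    fix A B assume "A \<in> U ` {1..n-1}" "B \<in> U ` {1..n-1}"
    then obtain i j where "A = U i" "B = U j" "i \<le> n" "j \<le> n" by auto
    then show "A \<subseteq> B \<or> B \<subseteq> A" using full_flag_mono[OF U] by (metis nle_le)
  qed
  moreover have "vct.subspace (U i) \<and> U i \<noteq> {0} \<and> U i \<subset> Vsp n" if "i \<in> {1..n-1}" for i
  proof -
    have "0 < i" "i < n" using that by auto
    then show ?thesis
      using full_flag_strict_mono[OF U, of 0 i] full_flag_strict_mono[OF U, of i n]
        full_flag_subspace[OF U, of i]
      by (auto simp: full_flag_top[OF U] full_flag_0[OF U])
  qed
  then have "U ` {1..n-1} \<subseteq> {A. vct.subspace A \<and> A \<noteq> {0} \<and> A \<subset> Vsp n}" by blast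
  ultimately show ?thesis using n
    by (simp add: simplices_def XV_def flag_complex_def)
qed

text \<open>The \<open>n - 1\<close> members have distinct dimensions in \<open>{1..n-1}\<close>, so
  each dimension occurs exactly once and can serve as the index.\<close>

lemma simplex_full_flag:
  fixes \<sigma> :: "(nat \<Rightarrow> 'a::field) set set"
  assumes \<sigma>: "\<sigma> \<in> simplices (XV n) (int n - 2)" and n: "n \<ge> 2"
  obtains U where "full_flag n U" "\<sigma> = U ` {1..n-1}"
proof -
  have fin: "finite \<sigma>" and ch: "chain\<^sub>\<subseteq> \<sigma>" and card: "card \<sigma> = n - 1"
    and sub: "\<And>A. A \<in> \<sigma> \<Longrightarrow> vct.subspace A \<and> A \<noteq> {0} \<and> A \<subset> Vsp n"
    using \<sigma> n by (auto simp: simplices_def XV_def flag_complex_def)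
  have lt: "vct.dim A < vct.dim B" if "A \<in> \<sigma>" "B \<in> \<sigma>" "A \<subset> B" for A B
    using that sub[of A] sub[of B] by (intro dim_strict_mono) auto
  have inj: "inj_on vct.dim \<sigma>"
  proof (rule inj_onI)
    fix A B assume "A \<in> \<sigma>" "B \<in> \<sigma>" "vct.dim A = vct.dim B"
    then have "\<not> A \<subset> B" "\<not> B \<subset> A" "A \<subseteq> B \<or> B \<subseteq> A"
      using ch lt[of A B] lt[of B A] by (auto simp: chain_subset_def)
    then show "A = B" by blast
  qed
  have "vct.dim A \<in> {1..n-1}" if A: "A \<in> \<sigma>" for A
  proof -
    have "vct.dim {0::nat \<Rightarrow> 'a} < vct.dim A"
      using sub[OF A] vct.subspace_0[of A] by (intro dim_strict_mono[of _ _ n]) (auto simp: vct.subspace_single_0)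
    moreover have "vct.dim A < vct.dim (Vsp n :: (nat \<Rightarrow> 'a) set)"
      using sub[OF A] subspace_Vsp by (intro dim_strict_mono[of _ _ n]) auto
    moreover have "vct.dim (Vsp n :: (nat \<Rightarrow> 'a) set) \<le> n" by (intro dim_Vsp_le) auto
    ultimately show ?thesis by auto
  qed
  then have "vct.dim ` \<sigma> = {1..n-1}"
    using card card_image[OF inj] by (intro card_subset_eq) auto
  then have bij: "bij_betw vct.dim \<sigma> {1..n-1}" using inj by (simp add: bij_betw_def)
  define V where "V = inv_into \<sigma> vct.dim"
  have V: "V i \<in> \<sigma>" "vct.dim (V i) = i" if "i \<in> {1..n-1}" for i
    using that bij unfolding V_def
    by (auto simp: bij_betw_def inv_into_into f_inv_into_f)
  have V\<sigma>: "V ` {1..n-1} = \<sigma>"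
    using bij unfolding V_def by (metis bij_betw_imp_surj_on bij_betw_inv_into)
  define U where "U i = (if i = 0 then {0} else if i = n then Vsp n else V i)" for i
  have "U i \<subset> U (Suc i)" if i: "i < n" for i
  proof -
    consider "i = 0" | "0 < i" "Suc i = n" | "0 < i" "Suc i < n" using i by linarith
    then show ?thesis
    proof cases
      case 1
      have "1 \<in> {1..n-1}" using n by auto
      then show ?thesis using 1 sub[OF V(1), of 1] vct.subspace_0[of "V 1"] n by (auto simp: U_def)
    next
      case 2
      then show ?thesis using sub[OF V(1), of i] by (auto simp: U_def)
    next
      case 3
      then have "V i \<in> \<sigma>" "V (Suc i) \<in> \<sigma>" "vct.dim (V i) = i" "vct.dim (V (Suc i)) = Suc i"
        using V[of i] V[of "Suc i"] by auto
      then have "V i \<subset> V (Suc i)"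
        using ch lt[of "V (Suc i)" "V i"] by (auto simp: chain_subset_def)
      then show ?thesis using 3 by (simp add: U_def)
    qed
  qed
  moreover have "vct.subspace (U i)" if "i \<le> n" for i
    using that sub[OF V(1), of i] subspace_Vsp by (auto simp: U_def vct.subspace_single_0)
  ultimately have "full_flag n U" using n by (simp add: full_flag_def U_def)
  moreover have "\<sigma> = U ` {1..n-1}"
    unfolding V\<sigma>[symmetric] by (intro image_cong) (auto simp: U_def)
  ultimately show ?thesis by (rule that)
qed

lemma finite_simplices_XV: "finite (simplices (XV n :: (nat \<Rightarrow> 'a::{field, finite}) set set set) p)"
proof (rule finite_subset)
  show "simplices (XV n :: (nat \<Rightarrow> 'a) set set set) p \<subseteq> Pow (Pow (Vsp n))"
    by (auto simp: simplices_def XV_def flag_complex_def)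
qed (simp add: finite_Vsp)

text \<open>Hence the sign of a face depends only on the dimension of the deleted member.\<close>

lemma position_full_flag:
  assumes U: "full_flag n U" and i: "i \<in> {1..n-1}"
  shows "position dim_prec (U ` {1..n-1}) (U i) = i"
proof -
  have "{t \<in> U ` {1..n-1}. dim_prec t (U i)} = U ` {1..<i}"
    using i full_flag_dim[OF U] by (force simp: dim_prec_def)
  moreover have "inj_on U {1..<i}" using full_flag_inj[OF U] by (rule inj_on_subset) (use i in auto)
  ultimately show ?thesis using i by (simp add: position_def card_image)
qed

lemma full_flag_image_minus:
  assumes U: "full_flag n U" and i: "i \<in> {1..n-1}"
  shows "U ` {1..n-1} - {U i} = U ` ({1..n-1} - {i})"
proof -
  have "inj_on U {1..n-1}" using full_flag_inj[OF U] by (rule inj_on_subset) auto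
  then show ?thesis using i by (subst inj_on_image_set_diff[of U "{1..n-1}"]) auto
qed

section \<open>The cycle condition along full flags\<close>

text \<open>The connecting maps of \<open>gsys\<close> are identities on ambient vectors, so the
  formula holds for every function \<open>c\<close>, chain or not.\<close>

lemma boundary_apply:
  "boundary prec X (gsys n) p c \<tau> =
     (\<Sum>\<sigma>\<in>simplices X p. \<Sum>s\<in>\<sigma>. if \<sigma> - {s} = \<tau> then signed (position prec \<sigma> s + 1) (c \<sigma>) else 0)"
  unfolding boundary_def sum_fun_apply[where t = \<tau>]
  by (intro sum.cong refl) (simp add: single_def gsys_def)

lemma signed_sum: "signed k (\<Sum>i\<in>I. g i) = (\<Sum>i\<in>I. signed k (g i))"
  by (simp add: signed_def sum_negf)

lemma signed_eq_0_iff: "signed k m = 0 \<longleftrightarrow> m = 0"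
  by (simp add: signed_def)

lemma boundary_sum:
  "boundary prec X (gsys n) p (\<Sum>i\<in>I. g i) = (\<Sum>i\<in>I. boundary prec X (gsys n) p (g i))"
proof
  fix \<tau>
  have eq: "(if b then signed k (\<Sum>i\<in>I. g i \<sigma>) else 0) = (\<Sum>i\<in>I. if b then signed k (g i \<sigma>) else 0)" for b k \<sigma>
    by (simp add: signed_sum)
  have "boundary prec X (gsys n) p (\<Sum>i\<in>I. g i) \<tau> =
      (\<Sum>\<sigma>\<in>simplices X p. \<Sum>s\<in>\<sigma>. \<Sum>i\<in>I. if \<sigma> - {s} = \<tau> then signed (position prec \<sigma> s + 1) (g i \<sigma>) else 0)"
    unfolding boundary_apply by (intro sum.cong refl) (simp add: sum_fun_apply eq[symmetric])
  also have "\<dots> = (\<Sum>\<sigma>\<in>simplices X p. \<Sum>i\<in>I. \<Sum>s\<in>\<sigma>.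
      if \<sigma> - {s} = \<tau> then signed (position prec \<sigma> s + 1) (g i \<sigma>) else 0)"
    by (intro sum.cong refl sum.swap)
  also have "\<dots> = (\<Sum>i\<in>I. boundary prec X (gsys n) p (g i) \<tau>)"
    unfolding boundary_apply by (rule sum.swap)
  finally show "boundary prec X (gsys n) p (\<Sum>i\<in>I. g i) \<tau> = (\<Sum>i\<in>I. boundary prec X (gsys n) p (g i)) \<tau>"
    by (simp add: sum_fun_apply)
qed

text \<open>Here \<open>m\<close> is an arbitrary vector, because this is applied to apartment terms
  whose coefficient may lie outside the stalk of the flag.\<close>

lemma boundary_single_flag:
  fixes U :: "nat \<Rightarrow> (nat \<Rightarrow> 'a::{field, finite}) set"
  assumes U: "full_flag n U" and n: "n \<ge> 2"
  shows "boundary dim_prec (XV n) (gsys n) (int n - 2) (single (U ` {1..n-1}) m) =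
    (\<Sum>i=1..n-1. single (U ` ({1..n-1} - {i})) (signed (i + 1) m))"
proof -
  let ?\<sigma> = "U ` {1..n-1}"
  let ?g = "\<lambda>\<sigma>. \<Sum>s\<in>\<sigma>. single (\<sigma> - {s}) (signed (position dim_prec \<sigma> s + 1) (single ?\<sigma> m \<sigma>))"
  have inj: "inj_on U {1..n-1}" using full_flag_inj[OF U] by (rule inj_on_subset) auto
  have "?g \<sigma> = 0" if "\<sigma> \<noteq> ?\<sigma>" for \<sigma>
    using that by (intro sum.neutral) (auto simp: single_def signed_def fun_eq_iff)
  then have "(\<Sum>\<sigma>\<in>simplices (XV n) (int n - 2). ?g \<sigma>) = (\<Sum>\<sigma>\<in>{?\<sigma>}. ?g \<sigma>)"
    using full_flag_simplex[OF U n] by (intro sum.mono_neutral_right finite_simplices_XV) auto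
  also have "\<dots> = (\<Sum>s\<in>?\<sigma>. single (?\<sigma> - {s}) (signed (position dim_prec ?\<sigma> s + 1) m))"
    by (simp add: single_def)
  also have "\<dots> = (\<Sum>i=1..n-1. single (U ` ({1..n-1} - {i})) (signed (i + 1) m))"
    using position_full_flag[OF U] full_flag_image_minus[OF U]
    by (subst sum.reindex[OF inj]) (intro sum.cong, auto)
  finally show ?thesis by (simp add: boundary_def gsys_def)
qed

lemma D1_flag_stalk:
  assumes c: "c \<in> D1 n" and U: "full_flag n U" and n: "n \<ge> 2"
  shows "c (U ` {1..n-1}) \<in> U 1"
proof -
  have "c (U ` {1..n-1}) \<in> stalk (gsys n) (U ` {1..n-1})"
    using c full_flag_simplex[OF U n] by (auto simp: D1_def cycle_group_def chain_group_def)
  then show ?thesis using n by (auto simp: gsys_def split: if_splits)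
qed

lemma full_flag_mem_imageD:
  assumes "full_flag n U" "full_flag n U'" "j \<le> n" "U j \<in> U' ` J" "J \<subseteq> {0..n}"
  shows "j \<in> J" "U j = U' j"
proof -
  obtain l where "l \<in> J" "U j = U' l" using assms(4) by blast
  moreover have "j = l"
    using calculation full_flag_dim[OF assms(1,3)] full_flag_dim[OF assms(2), of l] assms(5) by auto
  ultimately show "j \<in> J" "U j = U' j" by auto
qed

lemma D1_flag_relation:
  fixes U :: "nat \<Rightarrow> (nat \<Rightarrow> 'a::{field, finite}) set"
  assumes c: "c \<in> D1 n" and U: "full_flag n U" and n: "n \<ge> 2" and i: "i \<in> {1..n-1}"
  shows "(\<Sum>M\<in>between (U (i - 1)) (U (Suc i)). c ((U(i := M)) ` {1..n-1})) = 0"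
proof -
  let ?X = "simplices (XV n :: (nat \<Rightarrow> 'a) set set set) (int n - 2)"
  define \<tau> where "\<tau> = U ` ({1..n-1} - {i})"
  \<comment> \<open>Pairs of a simplex and a member whose deletion leaves \<open>\<tau>\<close>;
    they are matched with the elements of \<open>between\<close> below.\<close>
  define P where "P = {p \<in> Sigma ?X (\<lambda>\<sigma>. \<sigma>). fst p - {snd p} = \<tau>}"
  have fin: "finite \<sigma>" if "\<sigma> \<in> ?X" for \<sigma> using that by (simp add: simplices_def)
  have P: "s \<in> between (U (i - 1)) (U (Suc i)) \<and> \<sigma> = (U(i := s)) ` {1..n-1} \<and> position dim_prec \<sigma> s = i"
    if "(\<sigma>, s) \<in> P" for \<sigma> s
  proof -
    have \<sigma>: "\<sigma> \<in> ?X" "s \<in> \<sigma>" "\<sigma> - {s} = \<tau>" using that by (auto simp: P_def)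
    obtain U' where U': "full_flag n U'" "\<sigma> = U' ` {1..n-1}" using simplex_full_flag[OF \<sigma>(1) n] .
    obtain i' where i': "i' \<in> {1..n-1}" "s = U' i'" using \<sigma>(2) U'(2) by blast
    have \<tau>': "\<tau> = U' ` ({1..n-1} - {i'})"
      using \<sigma>(3) full_flag_image_minus[OF U'(1) i'(1)] U'(2) i'(2) by simp
    have sub: "{1..n-1} - {l} \<subseteq> {0..n}" for l by auto
    have eq: "U j = U' j" and ne: "j \<noteq> i'" if "j \<in> {1..n-1} - {i}" for j
    proof -
      have mem: "U j \<in> U' ` ({1..n-1} - {i'})" using that \<tau>' unfolding \<tau>_def by blast
      have "j \<le> n" using that by auto
      note * = full_flag_mem_imageD[OF U U'(1) this mem sub]
      show "U j = U' j" by (rule *(2))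
      show "j \<noteq> i'" using *(1) by blast
    qed
    \<comment> \<open>Otherwise \<open>\<tau>\<close> would contain \<open>U i'\<close>, although
      the member of that dimension is the one deleted from \<open>\<sigma>\<close>.\<close>
    have "i' = i" using ne[of i'] i'(1) by blast
    have eq': "U j = U' j" if "j \<noteq> i" "j \<le> n" for j
    proof -
      have "j = 0 \<or> j = n \<or> j \<in> {1..n-1} - {i}" using that by auto
      then show ?thesis using eq[of j] full_flagD[OF U] full_flagD[OF U'(1)] by (elim disjE) simp_all
    qed
    have "i - 1 \<noteq> i" "i - 1 \<le> n" "Suc i \<noteq> i" "Suc i \<le> n" using i by auto
    then have "s \<in> between (U (i - 1)) (U (Suc i))"
      using full_flag_in_between[OF U'(1), of i] i eq' by (auto simp: i'(2) \<open>i' = i\<close>)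
    moreover have "\<sigma> = (U(i := s)) ` {1..n-1}"
      unfolding U'(2) by (intro image_cong) (auto simp: i'(2) \<open>i' = i\<close> eq')
    moreover have "position dim_prec \<sigma> s = i"
      using position_full_flag[OF U'(1) i'(1)] by (simp add: U'(2) i'(2) \<open>i' = i\<close>)
    ultimately show ?thesis by blast
  qed
  have Q: "((U(i := M)) ` {1..n-1}, M) \<in> P" if "M \<in> between (U (i - 1)) (U (Suc i))" for M
  proof -
    have f: "full_flag n (U(i := M))" using full_flag_update[OF U _ _ that] i by auto
    have "(U(i := M)) ` {1..n-1} - {M} = (U(i := M)) ` ({1..n-1} - {i})"
      using full_flag_image_minus[OF f i] by simp
    also have "\<dots> = \<tau>" unfolding \<tau>_def by (intro image_cong) auto
    finally show ?thesis using full_flag_simplex[OF f n] i by (auto simp: P_def)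
  qed
  have "boundary dim_prec (XV n) (gsys n) (int n - 2) c \<tau> =
      (\<Sum>p\<in>Sigma ?X (\<lambda>\<sigma>. \<sigma>). if fst p - {snd p} = \<tau>
         then signed (position dim_prec (fst p) (snd p) + 1) (c (fst p)) else 0)"
    unfolding boundary_apply using fin
    by (subst sum.Sigma) (auto simp: finite_simplices_XV case_prod_beta)
  also have "\<dots> = (\<Sum>p\<in>P. signed (position dim_prec (fst p) (snd p) + 1) (c (fst p)))"
    unfolding P_def using fin by (intro sum.inter_filter[symmetric] finite_SigmaI finite_simplices_XV)
  also have "\<dots> = (\<Sum>M\<in>between (U (i - 1)) (U (Suc i)). signed (i + 1) (c ((U(i := M)) ` {1..n-1})))"
    by (rule sum.reindex_bij_witness[of _ "\<lambda>M. ((U(i := M)) ` {1..n-1}, M)" snd])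
      (use P Q in \<open>force simp del: fun_upd_apply\<close>)+
  finally show ?thesis using c
    by (simp add: D1_def cycle_group_def signed_sum[symmetric] signed_eq_0_iff)
qed

section \<open>A propagation principle for cycles\<close>

text \<open>
  Flags are sorted by the least \<open>s\<close> with \<open>d \<in> U s\<close>. If \<open>U (s - 1)\<close> is not contained in \<open>H\<close>, the
  relation at \<open>s\<close> reduces \<open>s\<close> to \<open>s + 1\<close>, up to the hypothesis at \<open>m\<close>. If \<open>U (s - 1) \<subseteq> H\<close>, the relation
  at \<open>s - 1\<close> reduces \<open>s\<close> to \<open>s - 1\<close>, down to \<open>s = 1\<close>, where the relation at \<open>1\<close> puts \<open>cf U\<close> into
  \<open>U 1 \<inter> H = 0\<close>.
\<close>

lemma flag_functional_propagation:
  fixes cf :: "(nat \<Rightarrow> (nat \<Rightarrow> 'a::{field, finite}) set) \<Rightarrow> nat \<Rightarrow> 'a"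
  assumes stalk: "\<And>U. full_flag n U \<Longrightarrow> cf U \<in> U 1"
    and rel: "\<And>U i. full_flag n U \<Longrightarrow> i \<in> {1..n-1} \<Longrightarrow>
      (\<Sum>M\<in>between (U (i - 1)) (U (Suc i)). cf (U(i := M))) = 0"
    and H: "vct.subspace H" "d \<notin> H"
    and m: "2 \<le> m" "m \<le> n" and d: "d \<in> P m"
    and vanish: "\<And>U. full_flag n U \<Longrightarrow> (\<forall>j\<in>{m..n}. U j = P j) \<Longrightarrow> d \<notin> U (m - 1) \<Longrightarrow>
      \<not> U (m - 1) \<subseteq> H \<Longrightarrow> cf U = 0"
    and U: "full_flag n U" "\<forall>j\<in>{m..n}. U j = P j"
  shows "cf U = 0"
proof -
  have split: "cf U = - (\<Sum>M\<in>between (U (i - 1)) (U (Suc i)) - {U i}. cf (U(i := M)))"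
    if "full_flag n U" "i \<in> {1..n-1}" for U i
  proof -
    have "U (Suc i) \<subseteq> Vsp n" using that(2) by (intro full_flag_subset_Vsp[OF that(1)]) auto
    then have "between (U (i - 1)) (U (Suc i)) \<subseteq> Pow (Vsp n)"
      unfolding between_def by blast
    then have "finite (between (U (i - 1)) (U (Suc i)))"
      using finite_subset finite_Vsp by blast
    then have "cf (U(i := U i)) + (\<Sum>M\<in>between (U (i - 1)) (U (Suc i)) - {U i}. cf (U(i := M))) = 0"
      using rel[OF that] full_flag_in_between[OF that(1), of i] that(2)
      by (subst sum.remove[symmetric]) auto
    then show ?thesis by (simp add: eq_neg_iff_add_eq_0)
  qed
  have max: "M = U i" if "full_flag n U" "i \<in> {1..n-1}" "M \<in> between (U (i - 1)) (U (Suc i))" "U i \<subseteq> M"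
    for U i M
  proof (rule ccontr)
    assume "M \<noteq> U i"
    then have "U i \<subset> M" using that(4) by blast
    then have "M = U (Suc i)"
      using that(2,3) by (intro full_flag_no_between[OF that(1)]) (auto simp: between_def)
    then show False using that(3) by (simp add: between_def)
  qed
  \<comment> \<open>\<open>U i\<close> is spanned by \<open>U (i - 1)\<close> and \<open>d\<close>.
    With \<open>max\<close>, it is the only subspace between its neighbours that contains
    \<open>d\<close>.\<close>
  have d_in: "U i \<subseteq> M" if "full_flag n U" "i \<in> {1..n-1}" "M \<in> between (U (i - 1)) (U (Suc i))"
      "d \<in> U i" "d \<notin> U (i - 1)" "d \<in> M" for U i M
  proof -
    have i: "0 < i" "i < n" "i - 1 < n" "Suc (i - 1) = i" using that(2) by auto
    have "U (i - 1) \<subseteq> M \<inter> U i" "M \<inter> U i \<subseteq> U (Suc (i - 1))" "vct.subspace (M \<inter> U i)"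
      using full_flag_in_between[OF that(1) i(1,2)] that(3) i(4)
      by (auto simp: between_def intro: vct.subspace_inter)
    moreover have "U (i - 1) \<noteq> M \<inter> U i" using that by blast
    ultimately have "M \<inter> U i = U (Suc (i - 1))"
      using full_flag_no_between[OF that(1) i(3), of "M \<inter> U i"] by blast
    then show ?thesis using i(4) by auto
  qed
  \<comment> \<open>Any other \<open>M\<close> in place of \<open>U s\<close> misses
    \<open>d\<close>, so \<open>d\<close> first appears at \<open>s + 1\<close>; and
    \<open>M\<close> contains \<open>U (s - 1)\<close>, so it is not inside \<open>H\<close>
    either.\<close>
  have nonzero: "cf U = 0"
    if "s \<in> {1..m}" "full_flag n U" "\<forall>j\<in>{m..n}. U j = P j" "d \<in> U s" "d \<notin> U (s - 1)" "\<not> U (s - 1) \<subseteq> H"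
    for s U
    using that
  proof (induction "m - s" arbitrary: s U)
    case 0
    then have "s = m" by simp
    then show ?case using vanish 0 by blast
  next
    case (Suc k)
    have s: "s \<in> {1..n-1}" "s < m" "0 < s" "s < n" using Suc.hyps(2) Suc.prems(1) m by auto
    have "cf (U(s := M)) = 0" if "M \<in> between (U (s - 1)) (U (Suc s)) - {U s}" for M
    proof (rule Suc.hyps(1)[of "Suc s"])
      have M: "M \<in> between (U (s - 1)) (U (Suc s))" "M \<noteq> U s" using that by auto
      show "full_flag n (U(s := M))" by (rule full_flag_update[OF Suc.prems(2) s(3,4) M(1)])
      show "d \<in> (U(s := M)) (Suc s)"
        using full_flag_Suc[OF Suc.prems(2) s(4)] Suc.prems(4) by auto
      show "d \<notin> (U(s := M)) (Suc s - 1)"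
        using d_in[OF Suc.prems(2) s(1) M(1) Suc.prems(4,5)] max[OF Suc.prems(2) s(1) M(1)] M(2) by auto
      show "\<not> (U(s := M)) (Suc s - 1) \<subseteq> H"
        using M(1) Suc.prems(6) by (simp add: between_def) blast
    qed (use Suc.hyps(2) Suc.prems(3) s in auto)
    then show ?case using split[OF Suc.prems(2) s(1)] by simp
  qed
  have zero: "cf U = 0"
    if "s \<in> {1..m}" "full_flag n U" "\<forall>j\<in>{m..n}. U j = P j" "d \<in> U s" "d \<notin> U (s - 1)" "U (s - 1) \<subseteq> H"
    for s U
    using that
  proof (induction s arbitrary: U)
    case (Suc s)
    show ?case
    proof (cases "s = 0")
      case True
      have i: "1 \<in> {1..n-1}" "0 < (1::nat)" "1 < n" using m by auto
      \<comment> \<open>If \<open>M\<close> lies in \<open>H\<close>, so does the coefficient, being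
        an element of the least member \<open>M\<close>. Otherwise \<open>nonzero\<close> at index 2
        makes it 0.\<close>
      have "cf (U(1 := M)) \<in> H" if "M \<in> between (U (1 - 1)) (U (Suc 1)) - {U 1}" for M
      proof -
        have M: "M \<in> between (U (1 - 1)) (U (Suc 1))" "M \<noteq> U 1" using that by auto
        have f: "full_flag n (U(1 := M))" by (rule full_flag_update[OF Suc.prems(2) i(2,3) M(1)])
        show ?thesis
        proof (cases "M \<subseteq> H")
          case True
          then show ?thesis using stalk[OF f] by auto
        next
          case False
          have "cf (U(1 := M)) = 0"
          proof (rule nonzero[of 2])
            show "d \<in> (U(1 := M)) 2"
              using full_flag_Suc[OF Suc.prems(2) i(3)] Suc.prems(4) \<open>s = 0\<close>
              by (auto simp: numeral_2_eq_2)
            show "d \<notin> (U(1 := M)) (2 - 1)"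
              using d_in[OF Suc.prems(2) i(1) M(1)] max[OF Suc.prems(2) i(1) M(1)] M(2)
                Suc.prems(4,5) \<open>s = 0\<close> by auto
          qed (use f m Suc.prems(3) False in auto)
          then show ?thesis using vct.subspace_0[OF H(1)] by simp
        qed
      qed
      then have "cf U \<in> H"
        unfolding split[OF Suc.prems(2) i(1)]
        by (intro vct.subspace_neg[OF H(1)] vct.subspace_sum[OF H(1)])
      \<comment> \<open>\<open>U 1\<close> is a line that contains \<open>d\<close>, and
        \<open>d\<close> is not in \<open>H\<close>.\<close>
      moreover have "U 1 \<inter> H = {0}"
      proof (rule ccontr)
        assume ne: "U 1 \<inter> H \<noteq> {0}"
        have sub: "vct.subspace (U 1 \<inter> H)"
          using full_flag_subspace[OF Suc.prems(2), of 1] m H(1) by (intro vct.subspace_inter) auto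
        then have "U 1 \<inter> H = U (Suc 0)"
          using ne i(3) full_flag_0[OF Suc.prems(2)] vct.subspace_0[OF sub]
          by (intro full_flag_no_between[OF Suc.prems(2)]) auto
        then show False using Suc.prems(4) H(2) True by auto
      qed
      ultimately show ?thesis using stalk[OF Suc.prems(2)] by blast
    next
      case False
      then have s: "s \<in> {1..n-1}" "s < m" "0 < s" "s < n" "s - 1 < n" "Suc (s - 1) = s"
        using Suc.prems(1) m by auto
      \<comment> \<open>Here \<open>d\<close> first appears at \<open>Suc s\<close>. If
        \<open>M\<close> contains \<open>d\<close>, the index drops to \<open>s\<close> and the
        induction hypothesis applies; if not, \<open>M\<close> is not inside \<open>H\<close> and
        \<open>nonzero\<close> applies.\<close>
      have "cf (U(s := M)) = 0" if "M \<in> between (U (s - 1)) (U (Suc s)) - {U s}" for M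
      proof -
        have M: "M \<in> between (U (s - 1)) (U (Suc s))" "M \<noteq> U s" using that by auto
        have f: "full_flag n (U(s := M))" by (rule full_flag_update[OF Suc.prems(2) s(3,4) M(1)])
        have dU: "d \<notin> U s" "U s \<subseteq> H" using Suc.prems(5,6) by auto
        have U1: "U (s - 1) \<subseteq> U s" using full_flag_Suc[OF Suc.prems(2) s(5)] s(6) by auto
        \<comment> \<open>\<open>U (Suc s) \<inter> H\<close> contains \<open>U s\<close> but not
          \<open>d\<close>, so it equals \<open>U s\<close> and has no room for a different
          \<open>M\<close>.\<close>
        have "\<not> M \<subseteq> H"
        proof
          assume MH: "M \<subseteq> H"
          have sub: "vct.subspace (U (Suc s) \<inter> H)"
            using full_flag_subspace[OF Suc.prems(2), of "Suc s"] s(4) H(1) by (intro vct.subspace_inter) auto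
          have Us: "U s \<subseteq> U (Suc s) \<inter> H" using full_flag_Suc[OF Suc.prems(2) s(4)] dU(2) by blast
          have "U (Suc s) \<inter> H \<noteq> U (Suc s)" using Suc.prems(4) H(2) by auto
          then have "U (Suc s) \<inter> H = U s"
            using full_flag_no_between[OF Suc.prems(2) s(4) sub] Us by blast
          moreover have "M \<subseteq> U (Suc s) \<inter> H" using M(1) MH by (auto simp: between_def)
          ultimately have "M \<subseteq> U (Suc (s - 1))" using s(6) by simp
          then have "M = U (Suc (s - 1))"
            using M(1) by (intro full_flag_no_between[OF Suc.prems(2) s(5)]) (simp_all add: between_def)
          then show False using M(2) s(6) by simp
        qed
        show ?thesis
        proof (cases "d \<in> M")
          case True
          show ?thesis
          proof (rule Suc.IH[OF _ f])
            show "d \<notin> (U(s := M)) (s - 1)" "(U(s := M)) (s - 1) \<subseteq> H"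
              using U1 dU s(3) by auto
          qed (use True s(2,3) Suc.prems(3) in auto)
        next
          case False
          show ?thesis
            using f False s(2) Suc.prems(1,3,4) \<open>\<not> M \<subseteq> H\<close> by (intro nonzero[of "Suc s"]) auto
        qed
      qed
      then show ?thesis using split[OF Suc.prems(2) s(1)] by simp
    qed
  qed simp
  define s where "s = (LEAST s. d \<in> U s)"
  have dm: "d \<in> U m" using d U(2) m by auto
  have s: "d \<in> U s" "s \<le> m" unfolding s_def using dm by (auto intro: LeastI Least_le)
  have "s \<noteq> 0" using s(1) full_flag_0[OF U(1)] vct.subspace_0[OF H(1)] H(2) by (metis singletonD)
  then have "s \<in> {1..m}" "d \<notin> U (s - 1)"
    using s(2) not_less_Least[of "s - 1" "\<lambda>s. d \<in> U s"] by (auto simp: s_def)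
  then show ?thesis using zero nonzero s U by blast
qed

section \<open>The classes as sums of apartments\<close>

lemma tail_span_iff:
  "x \<in> vct.span (stdvec ` {i+1..n}) \<longleftrightarrow> (\<forall>j. j \<notin> {i+1..n} \<longrightarrow> x j = 0)"
proof
  assume x: "x \<in> vct.span (stdvec ` {i+1..n})"
  have "vct.span (stdvec ` {i+1..n}) \<subseteq> {x :: nat \<Rightarrow> 'a. \<forall>j. j \<notin> {i+1..n} \<longrightarrow> x j = 0}"
    by (rule vct.span_minimal) (auto simp: stdvec_def vct.subspace_def vscale_def)
  then show "\<forall>j. j \<notin> {i+1..n} \<longrightarrow> x j = 0" using x by blast
next
  assume x: "\<forall>j. j \<notin> {i+1..n} \<longrightarrow> x j = 0"
  have "x = (\<Sum>k\<in>{i+1..n}. vscale (x k) (stdvec k))"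
  proof
    fix j
    have "(\<Sum>k\<in>{i+1..n}. vscale (x k) (stdvec k)) j = (\<Sum>k\<in>{i+1..n}. if j = k then x k else 0)"
      unfolding sum_fun_apply by (intro sum.cong) (auto simp: vscale_def stdvec_def)
    then show "x j = (\<Sum>k\<in>{i+1..n}. vscale (x k) (stdvec k)) j" using x by auto
  qed
  also have "\<dots> \<in> vct.span (stdvec ` {i+1..n})"
    by (intro vct.span_sum vct.span_scale vct.span_base) auto
  finally show "x \<in> vct.span (stdvec ` {i+1..n})" .
qed

lemma Tset_iff:
  "v \<in> Tset n \<longleftrightarrow> v \<in> extensional {1..n-1} \<and>
     (\<forall>i\<in>{1..n-1}. v i \<in> Vsp n \<and> v i i = 1 \<and> (\<forall>j<i. v i j = 0) \<and> v i \<noteq> stdvec i)"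
proof -
  have "(\<exists>y. x = stdvec i + y \<and> y \<in> vct.span (stdvec ` {i+1..n})) \<longleftrightarrow>
      x \<in> Vsp n \<and> x i = 1 \<and> (\<forall>j<i. x j = 0)" (is "?L \<longleftrightarrow> ?R")
    if i: "i \<in> {1..n-1}" for i and x :: "nat \<Rightarrow> 'a"
  proof
    assume ?L
    then obtain y where y: "x = stdvec i + y" "\<forall>j. j \<notin> {i+1..n} \<longrightarrow> y j = 0"
      unfolding tail_span_iff by blast
    have "y j = 0" if "j \<le> i \<or> n < j" for j using y(2) that by auto
    then show ?R using i by (auto simp: y(1) Vsp_def stdvec_def)
  next
    assume R: ?R
    have "(x - stdvec i) j = 0" if "j \<notin> {i+1..n}" for j
    proof -
      have "j < i \<or> j = i \<or> j \<notin> {1..n} \<and> j \<noteq> i" using that i by auto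
      then show ?thesis using R by (auto simp: Vsp_def stdvec_def)
    qed
    then have "x = stdvec i + (x - stdvec i) \<and> x - stdvec i \<in> vct.span (stdvec ` {i+1..n})"
      unfolding tail_span_iff by simp
    then show ?L by blast
  qed
  then show ?thesis unfolding Tset_def PiE_iff by auto
qed

text \<open>Entry \<open>n\<close> is set explicitly because for \<open>v\<close> in
  \<open>Tset n\<close> and \<open>\<epsilon>\<close> in \<open>Eset n\<close> both have only their
  extensional default there.\<close>

definition yvec :: "nat \<Rightarrow> (nat \<Rightarrow> nat \<Rightarrow> 'a::field) \<Rightarrow> (nat \<Rightarrow> nat) \<Rightarrow> nat \<Rightarrow> nat \<Rightarrow> 'a" where
  "yvec n v \<epsilon> = (veps v \<epsilon>)(n := stdvec n)"

lemma unitriangular_yvec: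
  assumes "v \<in> Tset n"
  shows "unitriangular n (yvec n v \<epsilon>)"
  unfolding unitriangular_def
proof
  fix i assume i: "i \<in> {1..n}"
  show "yvec n v \<epsilon> i \<in> Vsp n \<and> yvec n v \<epsilon> i i = 1 \<and> (\<forall>j<i. yvec n v \<epsilon> i j = 0)"
  proof (cases "i = n \<or> \<epsilon> i = 0")
    case True
    then have "yvec n v \<epsilon> i = stdvec i" by (auto simp: yvec_def veps_def)
    then show ?thesis using stdvec_in_Vsp[OF i] by (simp add: stdvec_def)
  next
    case False
    then have "i \<in> {1..n-1}" using i by auto
    then have "v i \<in> Vsp n \<and> v i i = 1 \<and> (\<forall>j<i. v i j = 0)" using assms unfolding Tset_iff by blast
    then show ?thesis using False by (simp add: yvec_def veps_def)
  qed
qed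

text \<open>Counted so that the index is the dimension, as in \<open>full_flag\<close>.\<close>

definition oflag :: "nat \<Rightarrow> (nat \<Rightarrow> nat \<Rightarrow> 'a::field) \<Rightarrow> nat \<Rightarrow> (nat \<Rightarrow> 'a) set" where
  "oflag n y i = orth n (y ` {1..n-i})"

text \<open>Strictness at \<open>i\<close> is witnessed by the dual basis vector of
  \<open>y (\<rho> (n - i))\<close>: it belongs to member \<open>Suc i\<close> and not to member
  \<open>i\<close>.\<close>

lemma full_flag_oflag:
  assumes y: "unitriangular n y" and \<rho>: "\<rho> permutes {1..n}"
  shows "full_flag n (oflag n (y \<circ> \<rho>))"
  unfolding full_flag_def
proof (intro conjI allI impI)
  have "u = 0" if "u \<in> orth n (y ` {1..n})" for u
    by (rule unitriangular_unique[OF y]) (use that in \<open>auto simp: orth_def\<close>)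
  then have "orth n (y ` {1..n}) \<subseteq> {0}" by blast
  moreover have "(y \<circ> \<rho>) ` {1..n} = y ` {1..n}" by (metis image_comp permutes_image[OF \<rho>])
  ultimately show "oflag n (y \<circ> \<rho>) 0 = {0}"
    using vct.subspace_0[OF subspace_orth, of n "y ` {1..n}"] by (simp add: oflag_def) blast
  show "oflag n (y \<circ> \<rho>) n = Vsp n" by (simp add: oflag_def orth_def)
  fix i assume i: "i < n"
  let ?k = "n - i"
  have k: "?k \<in> {1..n}" "?k \<notin> {1..n - Suc i}" "{1..n - Suc i} \<subseteq> {1..?k}" "{1..?k} \<subseteq> {1..n}"
    using i by auto
  obtain u where u: "u \<in> Vsp n" "\<And>l. l \<in> {1..n} \<Longrightarrow> dotp n u (y l) = (if l = \<rho> ?k then 1 else 0)"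
    using unitriangular_solve[OF y, of "\<lambda>l. if l = \<rho> ?k then 1 else 0"] by blast
  have "dotp n u (y (\<rho> l)) = 0" if "l \<in> {1..n - Suc i}" for l
  proof -
    have "l \<in> {1..n}" "l \<noteq> ?k" using that k i by auto
    then have "\<rho> l \<in> {1..n}" "\<rho> l \<noteq> \<rho> ?k"
      using permutes_in_image[OF \<rho>] permutes_inj[OF \<rho>] by (simp_all add: inj_eq)
    then show ?thesis using u(2) by simp
  qed
  then have "u \<in> oflag n (y \<circ> \<rho>) (Suc i)" using u(1) by (auto simp: oflag_def orth_def)
  moreover have "dotp n u (y (\<rho> ?k)) \<noteq> 0" using u(2)[of "\<rho> ?k"] permutes_in_image[OF \<rho>] k(1) by auto
  then have "u \<notin> oflag n (y \<circ> \<rho>) i" using k(1) by (auto simp: oflag_def orth_def)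
  moreover have "oflag n (y \<circ> \<rho>) i \<subseteq> oflag n (y \<circ> \<rho>) (Suc i)"
    using k(3) unfolding oflag_def orth_def by auto
  ultimately show "oflag n (y \<circ> \<rho>) i \<subset> oflag n (y \<circ> \<rho>) (Suc i)" by blast
qed (simp add: oflag_def subspace_orth)

text \<open>In the basis dual to \<open>yvec n v \<epsilon>\<close>, the vector
  \<open>w(v^\<epsilon>)\<close> is the one belonging to \<open>e_n\<close>; this gives its
  existence and uniqueness.\<close>

lemma wvec_veps:
  assumes v: "v \<in> Tset n" and n: "n \<ge> 2"
  shows "wvec n (veps v \<epsilon>) \<in> Vsp n"
    and "i \<in> {1..n-1} \<Longrightarrow> dotp n (wvec n (veps v \<epsilon>)) (veps v \<epsilon> i) = 0"
    and "wvec n (veps v \<epsilon>) n = 1"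
proof -
  let ?Q = "\<lambda>w. w \<in> orth n (vct.span (veps v \<epsilon> ` {1..n-1})) \<and> dotp n w (stdvec n) = 1"
  have y: "yvec n v \<epsilon> i = veps v \<epsilon> i" if "i \<in> {1..n-1}" for i using that by (auto simp: yvec_def)
  have Q: "?Q w \<longleftrightarrow> w \<in> Vsp n \<and> (\<forall>i\<in>{1..n}. dotp n w (yvec n v \<epsilon> i) = (if i = n then 1 else 0))" for w
  proof -
    have "{1..n} = insert n {1..n-1}" using n by auto
    moreover have "\<forall>i\<in>{1..n-1}. i \<noteq> n" by auto
    ultimately have "(\<forall>i\<in>{1..n}. dotp n w (yvec n v \<epsilon> i) = (if i = n then 1 else 0)) \<longleftrightarrow>
       dotp n w (stdvec n) = 1 \<and> (\<forall>i\<in>{1..n-1}. dotp n w (veps v \<epsilon> i) = 0)"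
      using y by (simp add: yvec_def)
    then show ?thesis unfolding orth_span by (auto simp: orth_def)
  qed
  obtain u where "u \<in> Vsp n" "\<And>i. i \<in> {1..n} \<Longrightarrow> dotp n u (yvec n v \<epsilon> i) = (if i = n then 1 else 0)"
    using unitriangular_solve[OF unitriangular_yvec[OF v, of \<epsilon>], where b = "\<lambda>i. if i = n then 1 else 0"]
    by blast
  then have u: "?Q u" unfolding Q by blast
  have "u' = u" if u': "?Q u'" for u'
  proof -
    have "u' - u = 0"
      by (rule unitriangular_unique[OF unitriangular_yvec[OF v, of \<epsilon>]])
        (use u u' in \<open>unfold Q dotp_diff_left, auto intro: vct.subspace_diff[OF subspace_Vsp]\<close>)
    then show ?thesis by simp
  qed
  then have w: "?Q (wvec n (veps v \<epsilon>))"
    unfolding wvec_def using u by (intro theI[of ?Q u]) blast+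
  then show "wvec n (veps v \<epsilon>) \<in> Vsp n" unfolding orth_span by (simp add: orth_def)
  show "i \<in> {1..n-1} \<Longrightarrow> dotp n (wvec n (veps v \<epsilon>)) (veps v \<epsilon> i) = 0"
    using w unfolding orth_span by (simp add: orth_def)
  show "wvec n (veps v \<epsilon>) n = 1" using w n by (simp add: dotp_stdvec_right)
qed

section \<open>Maximal flags of \<open>sd(K)\<close> and their images in \<open>X_V\<close>\<close>

lemma Sflag_eq_image: "Sflag n x = (\<lambda>k. x ` {1..k}) ` {1..n-1}"
  by (auto simp: Sflag_def)

text \<open>A set of \<open>k\<close> vertices goes to a subspace of dimension \<open>n - k\<close>,
  so the flag is traversed in reverse.\<close>

lemma fmap_Sflag:
  assumes "\<And>i. i \<in> {1..n-1} \<Longrightarrow> theta n v (x i) = z i"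
  shows "fmap n v ` Sflag n x = oflag n z ` {1..n-1}"
proof -
  have "fmap n v (x ` {1..k}) = oflag n z (n - k)" if "k \<in> {1..n-1}" for k
  proof -
    have "theta n v ` x ` {1..k} = z ` {1..k}"
      unfolding image_image using assms that by (intro image_cong) auto
    moreover have "n - (n - k) = k" using that by auto
    ultimately show ?thesis by (simp only: fmap_def orth_span oflag_def)
  qed
  then have "fmap n v ` Sflag n x = (\<lambda>k. oflag n z (n - k)) ` {1..n-1}"
    unfolding Sflag_eq_image image_image by (intro image_cong) auto
  also have "\<dots> = oflag n z ` (\<lambda>k. n - k) ` {1..n-1}" by (simp add: image_image)
  also have "(\<lambda>k. n - k) ` {1..n-1} = {1..n-1}"
  proof (intro subset_antisym subsetI)
    fix k assume "k \<in> {1..n-1}"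
    then have "n - k \<in> {1..n-1}" "k = n - (n - k)" by auto
    then show "k \<in> (\<lambda>k. n - k) ` {1..n-1}" by blast
  qed auto
  finally show ?thesis .
qed

lemma Mcx_subset: "Mcx n \<subseteq> Pow ((\<lambda>(i, k). KA i k) ` ({1..n-1} \<times> {0, 1}))"
  unfolding Mcx_def Join_def by fastforce

lemma finite_Kcx: "finite (Kcx n)"
proof (rule finite_subset)
  show "Kcx n \<subseteq> Pow (insert KB ((\<lambda>(i, k). KA i k) ` ({1..n-1} \<times> {0, 1})))"
    using Mcx_subset[of n] unfolding Kcx_def join_def skeleton_def by blast
qed simp

lemma finite_simplices_sd_Kcx: "finite (simplices (sd (Kcx n)) p)"
proof (rule finite_subset)
  show "simplices (sd (Kcx n)) p \<subseteq> Pow (Kcx n)"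
    by (auto simp: simplices_def sd_def flag_complex_def)
qed (simp add: finite_Kcx)

lemma avec_in_Mcx:
  assumes "\<epsilon> \<in> Eset n" "J \<subseteq> {1..n-1}"
  shows "avec \<epsilon> ` J \<in> Mcx n"
proof -
  have "avec \<epsilon> ` J = (\<Union>i\<in>{1..n-1}. if i \<in> J then {KA i (\<epsilon> i)} else {})"
    using assms(2) by (auto simp: avec_def)
  moreover have "\<epsilon> i = 0 \<or> \<epsilon> i = 1" if "i \<in> {1..n-1}" for i
    using assms(1) that by (auto simp: Eset_def PiE_iff)
  then have "\<forall>i\<in>{1..n-1}. (if i \<in> J then {KA i (\<epsilon> i)} else {}) \<in> {{}, {KA i 0}, {KA i 1}}"
    by auto
  ultimately show ?thesis
    unfolding Mcx_def Join_def
    by (intro CollectI exI[of _ "\<lambda>i. if i \<in> J then {KA i (\<epsilon> i)} else {}"]) blast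
qed

text \<open>If \<open>KB\<close> occurs, at most \<open>n - 2\<close> other vertices remain, and
  these form a simplex of the \<open>(n - 3)\<close>-skeleton of \<open>Mcx n\<close>.\<close>

lemma avecb_in_Kcx:
  assumes "\<epsilon> \<in> Eset n" "J \<subseteq> {1..n-1}" "j \<in> {1..n-1}"
  shows "avecb \<epsilon> j ` J \<in> Kcx n"
proof (cases "j \<in> J")
  case False
  then have "avecb \<epsilon> j ` J = avec \<epsilon> ` J" by (intro image_cong) (auto simp: avecb_def)
  then show ?thesis using avec_in_Mcx[OF assms(1,2)] by (simp add: Kcx_def)
next
  case True
  then have eq: "avecb \<epsilon> j ` J = {KB} \<union> avec \<epsilon> ` (J - {j})"
    by (auto simp: avecb_def)
  have "finite J" using assms(2) finite_subset by blast
  have "card J \<le> n - 1" using card_mono[OF _ assms(2)] by simp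
  then have "card (J - {j}) \<le> n - 2" using True \<open>finite J\<close> by simp
  then have "card (avec \<epsilon> ` (J - {j})) \<le> n - 2"
    using card_image_le[of "J - {j}" "avec \<epsilon>"] \<open>finite J\<close> by simp
  then have "avec \<epsilon> ` (J - {j}) \<in> skeleton (Mcx n) (int n - 3)"
    using avec_in_Mcx[OF assms(1), of "J - {j}"] assms(2,3) \<open>finite J\<close> by (auto simp: skeleton_def)
  then show ?thesis unfolding eq Kcx_def join_def by blast
qed

lemma Sflag_simplex:
  assumes "inj_on x {1..n-1}" "n \<ge> 2" "\<And>k. k \<in> {1..n-1} \<Longrightarrow> x ` {1..k} \<in> X"
  shows "Sflag n x \<in> simplices (sd X) (int n - 2)"
proof -
  have c: "card (x ` {1..k}) = k" if "k \<in> {1..n-1}" for k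
    using that inj_on_subset[OF assms(1), of "{1..k}"] by (auto simp: card_image)
  have "inj_on (\<lambda>k. x ` {1..k}) {1..n-1}"
    by (rule inj_on_inverseI[where g = card]) (rule c)
  then have "card (Sflag n x) = n - 1" unfolding Sflag_eq_image by (simp add: card_image)
  moreover have "chain\<^sub>\<subseteq> (Sflag n x)"
    unfolding chain_subset_def
  proof (intro ballI)
    fix A B assume "A \<in> Sflag n x" "B \<in> Sflag n x"
    then obtain k l where "A = x ` {1..k}" "B = x ` {1..l}" by (auto simp: Sflag_def)
    then show "A \<subseteq> B \<or> B \<subseteq> A" using image_mono[of "{1..k}" "{1..l}" x] image_mono[of "{1..l}" "{1..k}" x]
      by (cases "k \<le> l") auto
  qed
  moreover have "Sflag n x \<subseteq> X - {{}}" using assms(3) by (auto simp: Sflag_def)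
  moreover have "finite (Sflag n x)" by (simp add: Sflag_eq_image)
  ultimately show ?thesis using assms(2) by (auto simp: simplices_def sd_def flag_complex_def)
qed

text \<open>\<open>\<epsilon>\<close> selects the apartment and \<open>\<rho>\<close> the order of
  its basis; the vector in position \<open>n\<close> is left out.\<close>

definition chamber ::
    "nat \<Rightarrow> (nat \<Rightarrow> nat \<Rightarrow> 'a::field) \<Rightarrow> (nat \<Rightarrow> nat) \<Rightarrow> (nat \<Rightarrow> nat) \<Rightarrow> (nat \<Rightarrow> 'a) set set" where
  "chamber n v \<epsilon> \<rho> = oflag n (yvec n v \<epsilon> \<circ> \<rho>) ` {1..n-1}"

lemma fmap_avec:
  assumes "\<pi> permutes {1..n-1}"
  shows "fmap n v ` Sflag n (avec \<epsilon> \<circ> \<pi>) = chamber n v \<epsilon> \<pi>"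
  unfolding chamber_def
proof (rule fmap_Sflag)
  fix i assume "i \<in> {1..n-1}"
  then have "\<pi> i \<in> {1..n-1}" using permutes_in_image[OF assms] by blast
  then have "\<pi> i \<noteq> n" by auto
  then show "theta n v ((avec \<epsilon> \<circ> \<pi>) i) = (yvec n v \<epsilon> \<circ> \<pi>) i"
    by (simp add: avec_def yvec_def veps_def)
qed

text \<open>As \<open>b\<close> goes to \<open>e_n\<close>, putting \<open>b\<close> in place of
  entry \<open>j\<close> exchanges the basis indices \<open>j\<close> and \<open>n\<close>. Index
  \<open>j\<close> then occupies the omitted position \<open>n\<close>, which is why
  \<open>\<epsilon>'\<close> may differ from \<open>\<epsilon>\<close> at \<open>j\<close>.\<close>

lemma fmap_avecb:
  assumes "\<pi> permutes {1..n-1}" and eq: "\<And>i. i \<noteq> j \<Longrightarrow> \<epsilon>' i = \<epsilon> i"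
  shows "fmap n v ` Sflag n (avecb \<epsilon> j \<circ> \<pi>) = chamber n v \<epsilon>' (transpose n j \<circ> \<pi>)"
  unfolding chamber_def
proof (rule fmap_Sflag)
  fix i assume "i \<in> {1..n-1}"
  then have "\<pi> i \<in> {1..n-1}" using permutes_in_image[OF assms(1)] by blast
  then have "\<pi> i \<noteq> n" by auto
  then show "theta n v ((avecb \<epsilon> j \<circ> \<pi>) i) = (yvec n v \<epsilon>' \<circ> (transpose n j \<circ> \<pi>)) i"
    using eq by (cases "\<pi> i = j") (simp_all add: avecb_def avec_def yvec_def veps_def)
qed

lemma single_zero: "single \<sigma> 0 = 0"
  and single_add: "single \<sigma> (a + b) = single \<sigma> a + single \<sigma> b"
  by (auto simp: single_def)

lemma finite_Eset: "finite (Eset n)"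
  by (simp add: Eset_def finite_PiE)

lemma finite_Eset0: "finite (Eset0 n j)"
  using finite_Eset by (simp add: Eset0_def)

lemma avec_Sflag_simplex:
  assumes "\<epsilon> \<in> Eset n" "\<pi> permutes {1..n-1}" "n \<ge> 2"
  shows "Sflag n (avec \<epsilon> \<circ> \<pi>) \<in> simplices (sd (Kcx n)) (int n - 2)"
proof (rule Sflag_simplex[OF inj_comp_perm[OF inj_avec assms(2)] assms(3)])
  fix k assume "k \<in> {1..n-1}"
  then have "{1..k} \<subseteq> {1..n-1}" by auto
  then have "\<pi> ` {1..k} \<subseteq> {1..n-1}" using permutes_image[OF assms(2)] by blast
  from avec_in_Mcx[OF assms(1) this] show "(avec \<epsilon> \<circ> \<pi>) ` {1..k} \<in> Kcx n"
    by (simp only: image_comp[symmetric] Kcx_def Un_iff simp_thms)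
qed

lemma avecb_Sflag_simplex:
  assumes "\<epsilon> \<in> Eset0 n j" "\<pi> permutes {1..n-1}" "j \<in> {1..n-1}" "n \<ge> 2"
  shows "Sflag n (avecb \<epsilon> j \<circ> \<pi>) \<in> simplices (sd (Kcx n)) (int n - 2)"
proof (rule Sflag_simplex[OF inj_comp_perm[OF inj_avecb assms(2)] assms(4)])
  fix k assume "k \<in> {1..n-1}"
  then have "{1..k} \<subseteq> {1..n-1}" by auto
  then have "\<pi> ` {1..k} \<subseteq> {1..n-1}" using permutes_image[OF assms(2)] by blast
  moreover have "\<epsilon> \<in> Eset n" using assms(1) by (simp add: Eset0_def)
  ultimately show "(avecb \<epsilon> j \<circ> \<pi>) ` {1..k} \<in> Kcx n"
    using avecb_in_Kcx[OF _ _ assms(3)] by (simp only: image_comp[symmetric])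
qed

text \<open>Grouped as in \<open>ccyc\<close>, so that each coefficient still lies in the stalk of
  its flag; this form is the one used for membership in the chain group.\<close>

lemma ctilde_eq_chamber_sums:
  assumes n: "n \<ge> 2"
  shows "ctilde n v =
      (\<Sum>\<epsilon>\<in>Eset n. \<Sum>\<pi> | \<pi> permutes {1..n-1}.
         single (chamber n v \<epsilon> \<pi>) (vscale (of_int (chi n \<epsilon> \<pi>)) (wvec n (veps v \<epsilon>)))) +
      (\<Sum>j=1..n-1. \<Sum>\<epsilon>\<in>Eset0 n j. \<Sum>\<pi> | \<pi> permutes {1..n-1}.
         single (chamber n v \<epsilon> (transpose n j \<circ> \<pi>))
           (vscale (of_int (chi n \<epsilon> \<pi>)) (wvec n (veps v (\<epsilon>(j := 1))) - wvec n (veps v \<epsilon>))))"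
proof -
  let ?P = "{\<pi>. \<pi> permutes {1..n-1}}"
  let ?X = "simplices (sd (Kcx n)) (int n - 2)"
  let ?g = "\<lambda>F. single (fmap n v ` F) (ccyc n v F)"
  define IA where "IA = Eset n \<times> ?P"
  define IB where "IB = Sigma {1..n-1} (\<lambda>j. Eset0 n j \<times> ?P)"
  define a where "a = (\<lambda>(\<epsilon>, \<pi>). Sflag n (avec \<epsilon> \<circ> \<pi>))"
  define b where "b = (\<lambda>(j, \<epsilon>, \<pi>). Sflag n (avecb \<epsilon> j \<circ> \<pi>))"
  have finP: "finite ?P" by (simp add: finite_permutations)
  have fin: "finite IA" "finite IB"
    unfolding IA_def IB_def using finP finite_Eset finite_Eset0 by (auto intro: finite_SigmaI)
  have injA: "inj_on a IA"
    unfolding a_def IA_def inj_on_def using avec_flag_unique[where n = n] by fast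
  have injB: "inj_on b IB"
    unfolding b_def IB_def inj_on_def using avecb_flag_unique[where n = n] by fast
  have disj: "a ` IA \<inter> b ` IB = {}"
    unfolding a_def b_def IA_def IB_def using avec_avecb_flag[where n = n] by fast
  have sub: "a ` IA \<union> b ` IB \<subseteq> ?X"
    unfolding a_def b_def IA_def IB_def
    using avec_Sflag_simplex[where n = n] avecb_Sflag_simplex[where n = n] n by auto
  have "?g F = 0" if "F \<in> ?X - (a ` IA \<union> b ` IB)" for F
  proof -
    have "\<not> (\<exists>\<epsilon>\<in>Eset n. \<exists>\<pi>. \<pi> permutes {1..n-1} \<and> F = Sflag n (avec \<epsilon> \<circ> \<pi>))"
    proof
      assume "\<exists>\<epsilon>\<in>Eset n. \<exists>\<pi>. \<pi> permutes {1..n-1} \<and> F = Sflag n (avec \<epsilon> \<circ> \<pi>)"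
      then obtain \<epsilon> \<pi> where "(\<epsilon>, \<pi>) \<in> IA" "F = a (\<epsilon>, \<pi>)" by (auto simp: IA_def a_def)
      then show False using that by blast
    qed
    moreover have "\<not> (\<exists>j\<in>{1..n-1}. \<exists>\<epsilon>\<in>Eset0 n j. \<exists>\<pi>. \<pi> permutes {1..n-1} \<and> F = Sflag n (avecb \<epsilon> j \<circ> \<pi>))"
    proof
      assume "\<exists>j\<in>{1..n-1}. \<exists>\<epsilon>\<in>Eset0 n j. \<exists>\<pi>. \<pi> permutes {1..n-1} \<and> F = Sflag n (avecb \<epsilon> j \<circ> \<pi>)"
      then obtain j \<epsilon> \<pi> where "(j, \<epsilon>, \<pi>) \<in> IB" "F = b (j, \<epsilon>, \<pi>)" by (auto simp: IB_def b_def)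
      then show False using that by blast
    qed
    ultimately have "ccyc n v F = 0" unfolding ccyc_def by (simp only: if_False)
    then show ?thesis by (simp only: single_zero)
  qed
  then have "ctilde n v = (\<Sum>F\<in>a ` IA \<union> b ` IB. ?g F)"
    unfolding ctilde_def push_forward_def
    by (intro sum.mono_neutral_right finite_simplices_sd_Kcx sub ballI)
  also have "\<dots> = (\<Sum>x\<in>IA. ?g (a x)) + (\<Sum>x\<in>IB. ?g (b x))"
    using fin disj by (simp add: sum.union_disjoint sum.reindex[OF injA] sum.reindex[OF injB])
  also have "(\<Sum>x\<in>IA. ?g (a x)) = (\<Sum>\<epsilon>\<in>Eset n. \<Sum>\<pi> | \<pi> permutes {1..n-1}.
         single (chamber n v \<epsilon> \<pi>) (vscale (of_int (chi n \<epsilon> \<pi>)) (wvec n (veps v \<epsilon>))))"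
    unfolding IA_def sum.cartesian_product
    by (intro sum.cong) (auto simp: a_def ccyc_a fmap_avec)
  also have "(\<Sum>x\<in>IB. ?g (b x)) = (\<Sum>j=1..n-1. \<Sum>\<epsilon>\<in>Eset0 n j. \<Sum>\<pi> | \<pi> permutes {1..n-1}.
         single (chamber n v \<epsilon> (transpose n j \<circ> \<pi>))
           (vscale (of_int (chi n \<epsilon> \<pi>)) (wvec n (veps v (\<epsilon>(j := 1))) - wvec n (veps v \<epsilon>))))"
    unfolding IB_def sum.cartesian_product
    by (subst sum.Sigma)
      (use finP finite_Eset0 in \<open>auto simp: b_def ccyc_b fmap_avecb intro!: sum.cong\<close>)
  finally show ?thesis .
qed

lemma Eset_eq_Eset0_Un:
  assumes "j \<in> {1..n-1}"
  shows "Eset n = Eset0 n j \<union> (\<lambda>\<epsilon>. \<epsilon>(j := 1)) ` Eset0 n j"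
proof (intro subset_antisym subsetI)
  fix \<epsilon> assume e: "\<epsilon> \<in> Eset n"
  then have "\<epsilon> j = 0 \<or> \<epsilon> j = 1" using assms by (auto simp: Eset_def PiE_iff)
  then show "\<epsilon> \<in> Eset0 n j \<union> (\<lambda>\<epsilon>. \<epsilon>(j := 1)) ` Eset0 n j"
  proof
    assume "\<epsilon> j = 1"
    then have "\<epsilon> = (\<epsilon>(j := 0))(j := 1)" by auto
    moreover have "\<epsilon>(j := 0) \<in> Eset0 n j"
      using e assms by (auto simp: Eset0_def Eset_def PiE_iff extensional_def)
    ultimately show ?thesis by blast
  qed (use e in \<open>simp add: Eset0_def\<close>)
next
  fix \<epsilon> assume "\<epsilon> \<in> Eset0 n j \<union> (\<lambda>\<epsilon>. \<epsilon>(j := 1)) ` Eset0 n j"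
  then show "\<epsilon> \<in> Eset n"
  proof
    assume "\<epsilon> \<in> (\<lambda>\<epsilon>. \<epsilon>(j := 1)) ` Eset0 n j"
    then obtain \<epsilon>' where "\<epsilon> = \<epsilon>'(j := 1)" "\<epsilon>' \<in> Eset n" by (auto simp: Eset0_def)
    then show ?thesis using assms by (simp add: Eset_def PiE_iff extensional_def)
  qed (simp add: Eset0_def)
qed

lemma sum_Eset:
  fixes g :: "(nat \<Rightarrow> nat) \<Rightarrow> 'm::ab_group_add"
  assumes "j \<in> {1..n-1}"
  shows "(\<Sum>\<epsilon>\<in>Eset n. g \<epsilon>) = (\<Sum>\<epsilon>\<in>Eset0 n j. g \<epsilon> + g (\<epsilon>(j := 1)))"
proof -
  have "inj_on (\<lambda>\<epsilon>. \<epsilon>(j := 1)) (Eset0 n j)"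
  proof (rule inj_on_inverseI[where g = "\<lambda>\<epsilon>. \<epsilon>(j := 0)"])
    fix \<epsilon> assume "\<epsilon> \<in> Eset0 n j"
    then show "(\<epsilon>(j := 1))(j := 0) = \<epsilon>" by (auto simp: Eset0_def)
  qed
  moreover have "Eset0 n j \<inter> (\<lambda>\<epsilon>. \<epsilon>(j := 1)) ` Eset0 n j = {}" by (auto simp: Eset0_def)
  ultimately show ?thesis
    unfolding Eset_eq_Eset0_Un[OF assms] using finite_Eset0[of n j]
    by (simp add: sum.union_disjoint sum.reindex sum.distrib)
qed

lemma chi_upd:
  assumes "\<epsilon> j = 0" "j \<in> {1..n-1}"
  shows "chi n (\<epsilon>(j := 1)) \<pi> = - chi n \<epsilon> \<pi>"
proof -
  have "(\<Sum>i=1..n-1. (\<epsilon>(j := 1)) i) = (\<Sum>i\<in>{1..n-1} - {j}. (\<epsilon>(j := 1)) i) + 1"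
    using assms(2) by (subst sum.remove[of _ j]) auto
  also have "(\<Sum>i\<in>{1..n-1} - {j}. (\<epsilon>(j := 1)) i) = (\<Sum>i\<in>{1..n-1} - {j}. \<epsilon> i)"
    by (intro sum.cong) auto
  also have "\<dots> = (\<Sum>i=1..n-1. \<epsilon> i)" using assms by (subst sum.remove[of _ j]) auto
  finally show ?thesis by (simp add: chi_def)
qed

lemma vscale_neg_left: "vscale (- t) u = - vscale t u"
  and vscale_diff_right: "vscale t (u - u') = vscale t u - vscale t u'"
  by (auto simp: vscale_def algebra_simps)

text \<open>
  The term \<open>F = S(\<pi>(a\<^sup>\<epsilon>\<^sup>,\<^sup>j))\<close> does not see \<open>\<epsilon>\<^sub>j\<close>, whereas \<open>\<chi>\<close> changes sign with \<open>\<epsilon>\<^sub>j\<close>. Hence the class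
  is an alternating sum over \<open>\<epsilon>\<close> of the vector \<open>w(v\<^sup>\<epsilon>)\<close> times the apartment of the basis
  \<open>(v\<^sup>\<epsilon>, e\<^sub>n)\<close>, the chambers of the apartment being indexed by permutations of \<open>{1..n}\<close>.
\<close>

lemma ctilde_apartments:
  assumes n: "n \<ge> 2"
  shows "ctilde n v = (\<Sum>\<epsilon>\<in>Eset n. \<Sum>\<rho> | \<rho> permutes {1..n}.
    single (chamber n v \<epsilon> \<rho>) (vscale (of_int (chi n \<epsilon> \<rho>)) (wvec n (veps v \<epsilon>))))"
proof -
  let ?P = "{\<pi>. \<pi> permutes {1..n-1}}"
  let ?g = "\<lambda>\<epsilon> \<rho>. single (chamber n v \<epsilon> \<rho>) (vscale (of_int (chi n \<epsilon> \<rho>)) (wvec n (veps v \<epsilon>)))"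
  have ins: "{1..n} = insert n {1..n-1}" using n by auto
  have nn: "n \<notin> {1..n-1}" by auto
  have chi: "chi n \<epsilon> (transpose n j \<circ> \<pi>) = - chi n \<epsilon> \<pi>" if "j \<in> {1..n-1}" "\<pi> permutes {1..n-1}" for \<epsilon> j \<pi>
  proof -
    have "permutation \<pi>" using that(2) permutes_imp_permutation[of "{1..n-1}"] by simp
    moreover have "n \<noteq> j" using that(1) by auto
    ultimately show ?thesis
      by (simp add: chi_def sign_compose permutation_swap_id sign_swap_id)
  qed
  \<comment> \<open>\<open>\<epsilon>\<close> and \<open>\<epsilon> + e_j\<close> give the same
    chamber with opposite signs. The extra sign of the transposition makes
    \<open>w(v^{\<epsilon>+e_j})\<close> the positive term.\<close>
  have eq: "?g \<epsilon> (transpose n j \<circ> \<pi>) + ?g (\<epsilon>(j := 1)) (transpose n j \<circ> \<pi>) =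
      single (chamber n v \<epsilon> (transpose n j \<circ> \<pi>))
           (vscale (of_int (chi n \<epsilon> \<pi>)) (wvec n (veps v (\<epsilon>(j := 1))) - wvec n (veps v \<epsilon>)))"
    if j: "j \<in> {1..n-1}" and p: "\<pi> permutes {1..n-1}" and e: "\<epsilon> \<in> Eset0 n j" for j \<pi> \<epsilon>
  proof -
    have "chamber n v (\<epsilon>(j := 1)) (transpose n j \<circ> \<pi>) = chamber n v \<epsilon> (transpose n j \<circ> \<pi>)"
      using fmap_avecb[OF p, of j "\<epsilon>(j := 1)" \<epsilon> v] fmap_avecb[OF p, of j \<epsilon> \<epsilon> v] by simp
    moreover have "\<epsilon> j = 0" using e by (simp add: Eset0_def)
    ultimately show ?thesis
      using chi[OF j p] chi_upd[OF _ j]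
      by (simp add: single_add[symmetric] vscale_neg_left vscale_diff_right)
  qed
  \<comment> \<open>Each permutation of \<open>{1..n}\<close> is uniquely
    \<open>transpose n j\<close> after some \<open>\<pi>\<close> fixing \<open>n\<close>;
    \<open>j = n\<close> gives the chambers without \<open>b\<close>.\<close>
  have "(\<Sum>\<epsilon>\<in>Eset n. \<Sum>\<rho> | \<rho> permutes {1..n}. ?g \<epsilon> \<rho>) =
      (\<Sum>\<epsilon>\<in>Eset n. (\<Sum>\<pi>\<in>?P. ?g \<epsilon> \<pi>) + (\<Sum>j=1..n-1. \<Sum>\<pi>\<in>?P. ?g \<epsilon> (transpose n j \<circ> \<pi>)))"
    unfolding ins sum_over_permutations_insert[OF finite_atLeastAtMost nn]
    by (subst sum.insert[OF finite_atLeastAtMost nn]) simp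
  also have "\<dots> = (\<Sum>\<epsilon>\<in>Eset n. \<Sum>\<pi>\<in>?P. ?g \<epsilon> \<pi>) +
      (\<Sum>j=1..n-1. \<Sum>\<epsilon>\<in>Eset n. \<Sum>\<pi>\<in>?P. ?g \<epsilon> (transpose n j \<circ> \<pi>))"
    by (simp only: sum.distrib) (subst sum.swap, rule refl)
  also have "(\<Sum>j=1..n-1. \<Sum>\<epsilon>\<in>Eset n. \<Sum>\<pi>\<in>?P. ?g \<epsilon> (transpose n j \<circ> \<pi>)) =
      (\<Sum>j=1..n-1. \<Sum>\<epsilon>\<in>Eset0 n j. \<Sum>\<pi>\<in>?P. single (chamber n v \<epsilon> (transpose n j \<circ> \<pi>))
           (vscale (of_int (chi n \<epsilon> \<pi>)) (wvec n (veps v (\<epsilon>(j := 1))) - wvec n (veps v \<epsilon>))))"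
  proof (rule sum.cong[OF refl])
    fix j assume j: "j \<in> {1..n-1}"
    show "(\<Sum>\<epsilon>\<in>Eset n. \<Sum>\<pi>\<in>?P. ?g \<epsilon> (transpose n j \<circ> \<pi>)) =
      (\<Sum>\<epsilon>\<in>Eset0 n j. \<Sum>\<pi>\<in>?P. single (chamber n v \<epsilon> (transpose n j \<circ> \<pi>))
           (vscale (of_int (chi n \<epsilon> \<pi>)) (wvec n (veps v (\<epsilon>(j := 1))) - wvec n (veps v \<epsilon>))))"
      unfolding sum_Eset[OF j] sum.distrib[symmetric]
      by (intro sum.cong refl eq[OF j]) simp_all
  qed
  finally show ?thesis unfolding ctilde_eq_chamber_sums[OF n] by (rule sym)
qed

section \<open>The classes are cycles with coefficients in the stalks\<close>

text \<open>Even permutations are paired with odd ones. Reindexing the whole sum would only show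
  that twice the sum is 0, which says nothing in characteristic 2.\<close>

lemma sum_permutations_alternating:
  fixes g :: "(nat \<Rightarrow> nat) \<Rightarrow> 'm::ab_group_add"
  assumes S: "finite S" "a \<in> S" "b \<in> S" "a \<noteq> b"
    and g: "\<And>\<rho>. \<rho> permutes S \<Longrightarrow> g (\<rho> \<circ> transpose a b) = - g \<rho>"
  shows "(\<Sum>\<rho> | \<rho> permutes S. g \<rho>) = 0"
proof -
  let ?E = "{\<rho>. \<rho> permutes S \<and> evenperm \<rho>}" and ?O = "{\<rho>. \<rho> permutes S \<and> \<not> evenperm \<rho>}"
  have t: "transpose a b permutes S" using S by (intro permutes_swap_id)
  have ev: "evenperm (\<rho> \<circ> transpose a b) \<longleftrightarrow> \<not> evenperm \<rho>" if "\<rho> permutes S" for \<rho>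
    using that permutes_imp_permutation[OF S(1)] t S(4) by (simp add: evenperm_comp evenperm_swap)
  have fin: "finite ?E" "finite ?O" using finite_permutations[OF S(1)] by auto
  have "(\<Sum>\<rho>\<in>?O. g \<rho>) = (\<Sum>\<rho>\<in>?E. g (\<rho> \<circ> transpose a b))"
    by (rule sum.reindex_bij_witness[of _ "\<lambda>\<rho>. \<rho> \<circ> transpose a b" "\<lambda>\<rho>. \<rho> \<circ> transpose a b"])
      (use ev permutes_compose[OF t] in \<open>auto simp: comp_assoc\<close>)
  also have "\<dots> = (\<Sum>\<rho>\<in>?E. - g \<rho>)" using g by (intro sum.cong) auto
  finally have "(\<Sum>\<rho>\<in>?E. g \<rho>) + (\<Sum>\<rho>\<in>?O. g \<rho>) = 0" by (simp add: sum_negf)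
  moreover have "(\<Sum>\<rho>\<in>?E \<union> ?O. g \<rho>) = (\<Sum>\<rho>\<in>?E. g \<rho>) + (\<Sum>\<rho>\<in>?O. g \<rho>)"
    by (rule sum.union_disjoint[OF fin]) auto
  moreover have "?E \<union> ?O = {\<rho>. \<rho> permutes S}" by auto
  ultimately show ?thesis by metis
qed

text \<open>Swapping the positions \<open>n - i\<close> and \<open>n - i + 1\<close> changes only
  the member of dimension \<open>i\<close>, so two chambers of opposite sign share the face without
  it. The cancellation takes place within each \<open>\<epsilon>\<close>, where the vector is
  constant.\<close>

lemma boundary_ctilde:
  fixes v :: "nat \<Rightarrow> nat \<Rightarrow> 'a::{field, finite}"
  assumes v: "v \<in> Tset n" and n: "n \<ge> 2"
  shows "boundary dim_prec (XV n) (gsys n) (int n - 2) (ctilde n v) = 0"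
proof -
  let ?S = "\<lambda>\<epsilon> i \<rho>. single (oflag n (yvec n v \<epsilon> \<circ> \<rho>) ` ({1..n-1} - {i}))
      (signed (i + 1) (vscale (of_int (chi n \<epsilon> \<rho>)) (wvec n (veps v \<epsilon>))))"
  have zero: "(\<Sum>\<rho> | \<rho> permutes {1..n}. ?S \<epsilon> i \<rho>) = 0" if i: "i \<in> {1..n-1}" for i \<epsilon>
  proof (rule sum_permutations_alternating)
    let ?t = "transpose (n - i) (Suc (n - i))"
    show "finite {1..n}" "n - i \<in> {1..n}" "Suc (n - i) \<in> {1..n}" "n - i \<noteq> Suc (n - i)" using i by auto
    fix \<rho> assume \<rho>: "\<rho> permutes {1..n}"
    \<comment> \<open>For \<open>k \<noteq> i\<close>, the initial segment contains both swapped
      positions or neither.\<close>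
    have im: "?t ` {1..n - k} = {1..n - k}" if "k \<in> {1..n-1} - {i}" for k
    proof -
      have "n - k < n - i \<or> Suc (n - i) \<le> n - k" using that i by auto
      then have "n - i \<in> {1..n - k} \<longleftrightarrow> Suc (n - i) \<in> {1..n - k}" using i by auto
      then show ?thesis by (rule transpose_image_eq)
    qed
    have "oflag n (yvec n v \<epsilon> \<circ> (\<rho> \<circ> ?t)) k = oflag n (yvec n v \<epsilon> \<circ> \<rho>) k" if "k \<in> {1..n-1} - {i}" for k
      unfolding oflag_def using im[OF that] by (metis image_comp)
    then have "oflag n (yvec n v \<epsilon> \<circ> (\<rho> \<circ> ?t)) ` ({1..n-1} - {i}) = oflag n (yvec n v \<epsilon> \<circ> \<rho>) ` ({1..n-1} - {i})"
      by (intro image_cong refl)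
    moreover have "permutation \<rho>" using \<rho> permutes_imp_permutation[of "{1..n}"] by simp
    then have "chi n \<epsilon> (\<rho> \<circ> ?t) = - chi n \<epsilon> \<rho>"
      by (simp add: chi_def sign_compose permutation_swap_id sign_swap_id)
    ultimately show "?S \<epsilon> i (\<rho> \<circ> ?t) = - ?S \<epsilon> i \<rho>"
      by (simp only: vscale_neg_left of_int_minus) (auto simp: single_def signed_def fun_eq_iff)
  qed
  have "boundary dim_prec (XV n) (gsys n) (int n - 2) (ctilde n v) =
      (\<Sum>\<epsilon>\<in>Eset n. \<Sum>\<rho> | \<rho> permutes {1..n}. \<Sum>i=1..n-1. ?S \<epsilon> i \<rho>)"
    unfolding ctilde_apartments[OF n] boundary_sum chamber_def
    using boundary_single_flag[OF full_flag_oflag[OF unitriangular_yvec[OF v]] n]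
    by (intro sum.cong refl) simp
  also have "\<dots> = (\<Sum>\<epsilon>\<in>Eset n. \<Sum>i=1..n-1. \<Sum>\<rho> | \<rho> permutes {1..n}. ?S \<epsilon> i \<rho>)"
    by (intro sum.cong refl sum.swap)
  also have "\<dots> = 0" by (rule sum.neutral, rule ballI, rule sum.neutral, rule ballI, rule zero)
  finally show ?thesis .
qed

lemma chain_group_XV_subspace: "chn.subspace (chain_group (XV n) (gsys n) p)"
proof -
  have "vct.subspace (stalk (gsys n) \<sigma>)" if "\<sigma> \<in> XV n" for \<sigma> :: "(nat \<Rightarrow> 'a) set set"
    using that flag_Inter_in[of \<sigma>] subspace_Vsp by (auto simp: gsys_def XV_def flag_complex_def)
  then have sub: "vct.subspace (stalk (gsys n) \<sigma>)" if "\<sigma> \<in> simplices (XV n) p" for \<sigma> :: "(nat \<Rightarrow> 'a) set set"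
    using that by (simp add: simplices_def)
  show ?thesis
    unfolding chn.subspace_def chain_group_def
    using vct.subspace_0[OF sub] vct.subspace_add[OF sub] vct.subspace_scale[OF sub]
    by (auto simp: cscale_def vscale_def fun_eq_iff)
qed

lemma single_flag_in_chain_group:
  assumes U: "full_flag n U" and n: "n \<ge> 2" and m: "m \<in> U 1"
  shows "single (U ` {1..n-1}) m \<in> chain_group (XV n) (gsys n) (int n - 2)"
proof -
  have "U 1 \<subseteq> U i" if "i \<in> {1..n-1}" for i
    using that by (intro full_flag_mono[OF U]) auto
  then have "m \<in> \<Inter>(U ` {1..n-1})" using m by blast
  then have "m \<in> stalk (gsys n) (U ` {1..n-1})" using n by (auto simp: gsys_def)
  moreover have "0 \<in> stalk (gsys n) \<sigma>" if "\<sigma> \<in> simplices (XV n) p" for \<sigma> :: "(nat \<Rightarrow> 'a) set set" and p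
    using that local_system_gsys[of n] by (auto simp: local_system_def simplices_def)
  ultimately show ?thesis
    using full_flag_simplex[OF U n] by (auto simp: chain_group_def single_def)
qed

lemma ctilde_in_chain_group:
  fixes v :: "nat \<Rightarrow> nat \<Rightarrow> 'a::{field, finite}"
  assumes v: "v \<in> Tset n" and n: "n \<ge> 2"
  shows "ctilde n v \<in> chain_group (XV n) (gsys n) (int n - 2)"
proof -
  have ins: "{1..n} = insert n {1..n-1}" using n by auto
  have flag: "full_flag n (oflag n (yvec n v \<epsilon> \<circ> \<rho>))" if "\<rho> permutes {1..n}" for \<epsilon> \<rho>
    by (rule full_flag_oflag[OF unitriangular_yvec[OF v] that])
  have A: "single (chamber n v \<epsilon> \<pi>) (vscale t (wvec n (veps v \<epsilon>))) \<in> chain_group (XV n) (gsys n) (int n - 2)"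
    if p: "\<pi> permutes {1..n-1}" for \<epsilon> \<pi> t
    unfolding chamber_def
  proof (rule single_flag_in_chain_group[OF flag n])
    show "\<pi> permutes {1..n}" unfolding ins by (rule permutes_imp_permutes_insert[OF p])
    have "wvec n (veps v \<epsilon>) \<in> oflag n (yvec n v \<epsilon> \<circ> \<pi>) 1"
      unfolding oflag_def orth_def
    proof (safe)
      show "wvec n (veps v \<epsilon>) \<in> Vsp n" by (rule wvec_veps[OF v n])
      fix i assume "i \<in> {1..n-1}"
      then have i: "\<pi> i \<in> {1..n-1}" using permutes_in_image[OF p] by blast
      then have "\<pi> i \<noteq> n" by auto
      then show "dotp n (wvec n (veps v \<epsilon>)) ((yvec n v \<epsilon> \<circ> \<pi>) i) = 0"
        using wvec_veps(2)[OF v n i] by (simp add: yvec_def)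
    qed
    then show "vscale t (wvec n (veps v \<epsilon>)) \<in> oflag n (yvec n v \<epsilon> \<circ> \<pi>) 1"
      unfolding oflag_def by (rule vct.subspace_scale[OF subspace_orth])
  qed
  \<comment> \<open>The vectors of this chamber are \<open>e_n\<close> and those with index
    different from \<open>j\<close>. The latter are common to \<open>\<epsilon>\<close> and
    \<open>\<epsilon> + e_j\<close>, hence orthogonal to both \<open>w\<close>; and both pair to 1
    with \<open>e_n\<close>, so the difference is orthogonal to \<open>e_n\<close> too.\<close>
  have B: "single (chamber n v \<epsilon> (transpose n j \<circ> \<pi>)) (vscale t (wvec n (veps v (\<epsilon>(j := 1))) - wvec n (veps v \<epsilon>)))
      \<in> chain_group (XV n) (gsys n) (int n - 2)"
    if p: "\<pi> permutes {1..n-1}" and j: "j \<in> {1..n-1}" for \<epsilon> \<pi> t j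
    unfolding chamber_def
  proof (rule single_flag_in_chain_group[OF flag n])
    have "\<pi> permutes {1..n}" unfolding ins by (rule permutes_imp_permutes_insert[OF p])
    then show "transpose n j \<circ> \<pi> permutes {1..n}"
      using j n by (intro permutes_compose permutes_swap_id) auto
    let ?w = "wvec n (veps v (\<epsilon>(j := 1))) - wvec n (veps v \<epsilon>)"
    have "?w \<in> oflag n (yvec n v \<epsilon> \<circ> (transpose n j \<circ> \<pi>)) 1"
      unfolding oflag_def orth_def
    proof (safe)
      show "?w \<in> Vsp n" by (intro vct.subspace_diff[OF subspace_Vsp] wvec_veps[OF v n])
      fix i assume "i \<in> {1..n-1}"
      then have i: "\<pi> i \<in> {1..n-1}" using permutes_in_image[OF p] by blast
      then have ne: "\<pi> i \<noteq> n" by auto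
      show "dotp n ?w ((yvec n v \<epsilon> \<circ> (transpose n j \<circ> \<pi>)) i) = 0"
      proof (cases "\<pi> i = j")
        case True
        then show ?thesis using n wvec_veps(3)[OF v n]
          by (simp add: yvec_def dotp_stdvec_right)
      next
        case False
        have "veps v (\<epsilon>(j := 1)) (\<pi> i) = veps v \<epsilon> (\<pi> i)" using False by (simp add: veps_def)
        then show ?thesis
          using False ne wvec_veps(2)[OF v n i, of \<epsilon>] wvec_veps(2)[OF v n i, of "\<epsilon>(j := 1)"]
          by (simp add: yvec_def dotp_diff_left)
      qed
    qed
    then show "vscale t ?w \<in> oflag n (yvec n v \<epsilon> \<circ> (transpose n j \<circ> \<pi>)) 1"
      unfolding oflag_def by (rule vct.subspace_scale[OF subspace_orth])
  qed
  show ?thesis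
    unfolding ctilde_eq_chamber_sums[OF n]
    by (intro chn.subspace_add[OF chain_group_XV_subspace] chn.subspace_sum[OF chain_group_XV_subspace] A B) auto
qed

lemma ctilde_in_D1:
  fixes v :: "nat \<Rightarrow> nat \<Rightarrow> 'a::{field, finite}"
  assumes "v \<in> Tset n" and "n \<ge> 2"
  shows "ctilde n v \<in> D1 n"
  using ctilde_in_chain_group[OF assms] boundary_ctilde[OF assms] by (simp add: D1_def cycle_group_def)

section \<open>The dual system of chambers\<close>

text \<open>Membership of \<open>e_i + <e_{i+1}, ..., e_n>\<close>, that is, the condition of
  \<open>Tset\<close> on entry \<open>i\<close> apart from \<open>v_i \<noteq> e_i\<close>.\<close>

definition leading_one :: "nat \<Rightarrow> nat \<Rightarrow> (nat \<Rightarrow> 'a::field) \<Rightarrow> bool" where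
  "leading_one n i x \<longleftrightarrow> x \<in> Vsp n \<and> x i = 1 \<and> (\<forall>j<i. x j = 0)"

lemma unitriangular_extend:
  assumes "\<And>i. i \<in> {1..<k} \<Longrightarrow> leading_one n i (v i)"
  shows "unitriangular n (\<lambda>i. if i < k then v i else stdvec i)"
  unfolding unitriangular_def
proof
  fix i assume i: "i \<in> {1..n}"
  show "(if i < k then v i else stdvec i) \<in> Vsp n \<and> (if i < k then v i else stdvec i) i = 1 \<and>
      (\<forall>j<i. (if i < k then v i else stdvec i) j = 0)"
    using assms[of i] i stdvec_in_Vsp[OF i] by (cases "i < k") (auto simp: leading_one_def stdvec_def)
qed

text \<open>Together with \<open>tail_zero_imp_zero\<close>: the entries \<open>k, ..., n\<close>
  are linear coordinates on the orthogonal complement of \<open>v_1, ..., v_{k-1}\<close>.\<close>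

lemma solve_with_tail:
  assumes v: "\<And>i. i \<in> {1..<k} \<Longrightarrow> leading_one n i (v i)" and k: "1 \<le> k" "k \<le> n"
  obtains u where "u \<in> Vsp n" "\<And>i. i \<in> {1..<k} \<Longrightarrow> dotp n u (v i) = 0"
    "\<And>i. i \<in> {k..n} \<Longrightarrow> u i = b i"
proof -
  obtain u where u: "u \<in> Vsp n"
      "\<And>i. i \<in> {1..n} \<Longrightarrow> dotp n u (if i < k then v i else stdvec i) = (if i < k then 0 else b i)"
    using unitriangular_solve[OF unitriangular_extend[OF v], where b = "\<lambda>i. if i < k then 0 else b i"]
    by blast
  show ?thesis
  proof (rule that[OF u(1)])
    fix i assume "i \<in> {1..<k}"
    then show "dotp n u (v i) = 0" using u(2)[of i] k by simp
  next
    fix i assume "i \<in> {k..n}"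
    then show "u i = b i" using u(2)[of i] k by (simp add: dotp_stdvec_right)
  qed
qed

lemma tail_zero_imp_zero:
  assumes v: "\<And>i. i \<in> {1..<k} \<Longrightarrow> leading_one n i (v i)"
    and u: "u \<in> Vsp n" "\<And>i. i \<in> {1..<k} \<Longrightarrow> dotp n u (v i) = 0" "\<And>i. i \<in> {k..n} \<Longrightarrow> u i = 0"
  shows "u = 0"
proof (rule unitriangular_unique[OF unitriangular_extend[OF v] u(1)])
  fix i assume "i \<in> {1..n}"
  then show "dotp n u (if i < k then v i else stdvec i) = 0"
    using u(2)[of i] u(3)[of i] by (simp add: dotp_stdvec_right)
qed

lemma dotp_leading:
  assumes "leading_one n k x" "k \<in> {1..n}"
  shows "dotp n u x = (\<Sum>j=k..n. u j * x j)"
  unfolding dotp_def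
  by (rule sum.mono_neutral_right) (use assms in \<open>auto simp: leading_one_def\<close>)

text \<open>\<open>A\<close> is the kernel of the functional on the complement of
  \<open>v_1, ..., v_{k-1}\<close> that is 0 on \<open>A\<close> and 1 at \<open>d\<close>. In the
  coordinates \<open>k, ..., n\<close> it is the pairing with a vector \<open>x\<close> supported
  there. Since \<open>d\<close> has coordinates \<open>1, 0, ..., 0\<close>, its value at
  \<open>d\<close> is \<open>x k\<close>.\<close>

lemma hyperplane_normal:
  assumes v: "\<And>i. i \<in> {1..<k} \<Longrightarrow> leading_one n i (v i)" and k: "k \<in> {1..n}"
    and A: "vct.subspace A" "A \<subseteq> orth n (v ` {1..<k})" "d \<notin> A"
    and dec: "\<And>u. u \<in> orth n (v ` {1..<k}) \<Longrightarrow> \<exists>t. u - vscale t d \<in> A"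
    and d: "d \<in> orth n (v ` {1..<k})" "d k = 1" "\<And>j. j \<in> {k<..n} \<Longrightarrow> d j = 0"
  obtains x where "leading_one n k x" "A = {u \<in> orth n (v ` {1..<k}). dotp n u x = 0}"
proof -
  let ?W = "orth n (v ` {1..<k})"
  have k': "1 \<le> k" "k \<le> n" using k by auto
  \<comment> \<open>The basis of \<open>?W\<close> belonging to the coordinates
    \<open>k, ..., n\<close>.\<close>
  have "\<exists>g. g \<in> ?W \<and> (\<forall>i\<in>{k..n}. g i = (if i = j then 1 else 0))" for j
  proof -
    obtain u where "u \<in> Vsp n" "\<And>i. i \<in> {1..<k} \<Longrightarrow> dotp n u (v i) = 0"
      "\<And>i. i \<in> {k..n} \<Longrightarrow> u i = (if i = j then 1 else 0)"
      using solve_with_tail[OF v k', where b = "\<lambda>i. if i = j then 1 else 0"] by blast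
    then show ?thesis by (auto simp: orth_def)
  qed
  then obtain g where g: "\<And>j. g j \<in> ?W" "\<And>i j. i \<in> {k..n} \<Longrightarrow> g j i = (if i = j then 1 else 0)"
    by metis
  \<comment> \<open>The value of the functional at \<open>g j\<close>, read off from the
    decomposition of \<open>?W\<close> into \<open>A\<close> and the line of
    \<open>d\<close>.\<close>
  define l where "l j = (SOME t. g j - vscale t d \<in> A)" for j
  have l: "g j - vscale (l j) d \<in> A" for j unfolding l_def by (rule someI_ex[OF dec[OF g(1)]])
  define x where "x = (\<lambda>j. if j \<in> {k..n} then l j else 0)"
  let ?s = "\<lambda>u. \<Sum>j=k..n. u j * x j"
  have decx: "u - vscale (?s u) d \<in> A" if u: "u \<in> ?W" for u
  proof -
    let ?u = "u - (\<Sum>j\<in>{k..n}. vscale (u j) (g j))"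
    have "?u \<in> ?W"
      by (intro vct.subspace_diff[OF subspace_orth] vct.subspace_sum[OF subspace_orth]
          vct.subspace_scale[OF subspace_orth] u g)
    moreover have "?u i = 0" if "i \<in> {k..n}" for i
    proof -
      have "(\<Sum>j\<in>{k..n}. vscale (u j) (g j)) i = (\<Sum>j\<in>{k..n}. if i = j then u j else 0)"
        unfolding sum_fun_apply using g(2)[OF that] by (intro sum.cong) (auto simp: vscale_def)
      then show ?thesis using that by simp
    qed
    ultimately have "?u = 0"
      by (intro tail_zero_imp_zero[OF v]) (auto simp: orth_def)
    then have "u = (\<Sum>j\<in>{k..n}. vscale (u j) (g j))" by simp
    moreover have "vscale (?s u) d = (\<Sum>j\<in>{k..n}. vscale (u j) (vscale (l j) d))"
      unfolding vct.scale_sum_left by (intro sum.cong refl) (simp add: x_def)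
    ultimately have "u - vscale (?s u) d = (\<Sum>j\<in>{k..n}. vscale (u j) (g j)) - (\<Sum>j\<in>{k..n}. vscale (u j) (vscale (l j) d))"
      by (rule arg_cong2[where f = minus])
    also have "\<dots> = (\<Sum>j\<in>{k..n}. vscale (u j) (g j - vscale (l j) d))"
      by (simp only: sum_subtractf[symmetric] vct.scale_right_diff_distrib)
    also have "\<dots> \<in> A" by (intro vct.subspace_sum[OF A(1)] vct.subspace_scale[OF A(1)] l)
    finally show ?thesis .
  qed
  have scal: "t = 0" if "vscale t d \<in> A" for t
  proof (rule ccontr)
    assume "t \<noteq> 0"
    then have "vscale (1 / t) (vscale t d) = d" by (simp add: vscale_def)
    then show False using vct.subspace_scale[OF A(1) that, of "1 / t"] A(3) by simp
  qed
  have "?s d = (\<Sum>j=k..n. if j = k then x k else 0)"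
    using d(2,3) by (intro sum.cong) auto
  then have sd: "?s d = x k" using k' by simp
  have "vscale (1 - x k) d = d - vscale (?s d) d" unfolding sd by (simp add: vct.scale_left_diff_distrib)
  then have "1 - x k = 0" using decx[OF d(1)] by (intro scal) simp
  then have x: "leading_one n k x" using k' by (auto simp: leading_one_def x_def Vsp_def)
  have "u \<in> A \<longleftrightarrow> dotp n u x = 0" if u: "u \<in> ?W" for u
  proof
    assume "u \<in> A"
    then have "u - (u - vscale (?s u) d) \<in> A" using decx[OF u] by (rule vct.subspace_diff[OF A(1)])
    then have "vscale (?s u) d \<in> A" by simp
    then show "dotp n u x = 0" unfolding dotp_leading[OF x k] by (rule scal)
  next
    assume "dotp n u x = 0"
    then have "?s u = 0" unfolding dotp_leading[OF x k] .
    then show "u \<in> A" using decx[OF u] by simp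
  qed
  then have "A = {u \<in> ?W. dotp n u x = 0}" using A(2) by blast
  with x show ?thesis by (rule that)
qed

text \<open>A prefix \<open>v_1, ..., v_k\<close> prescribes the members of dimension at least
  \<open>n - k\<close>. When it is complete, the flag is a dual flag; otherwise the propagation
  principle reduces to the flags whose next member also has an admissible normal vector.\<close>

lemma D1_vanishing:
  fixes c :: "(nat \<Rightarrow> 'a::{field, finite}) set set \<Rightarrow> nat \<Rightarrow> 'a"
  assumes c: "c \<in> D1 n" and n: "n \<ge> 2"
    and van: "\<And>v. v \<in> Tset n \<Longrightarrow> c (oflag n v ` {1..n-1}) = 0"
    and U: "full_flag n U"
  shows "c (U ` {1..n-1}) = 0"
proof -
  have claim: "c (U ` {1..n-1}) = 0"
    if "k \<le> n - 1" "full_flag n U" "\<And>i. i \<in> {1..k} \<Longrightarrow> leading_one n i (v i) \<and> v i \<noteq> stdvec i"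
      "\<And>i. i \<le> k \<Longrightarrow> U (n - i) = orth n (v ` {1..i})" for k U v
    using that
  proof (induction "n - 1 - k" arbitrary: k U v)
    case 0
    then have k: "k = n - 1" by simp
    \<comment> \<open>Membership in \<open>Tset n\<close> also fixes the default value outside
      \<open>{1..n-1}\<close>.\<close>
    define v' where "v' = restrict v {1..n-1}"
    have "v' \<in> Tset n"
      using 0(4) unfolding Tset_iff v'_def k by (auto simp: leading_one_def)
    moreover have "U i = oflag n v' i" if "i \<in> {1..n-1}" for i
    proof -
      have "U (n - (n - i)) = orth n (v ` {1..n-i})" using 0(5)[of "n - i"] that k by auto
      moreover have "n - (n - i) = i" using that by auto
      moreover have "v ` {1..n-i} = v' ` {1..n-i}" unfolding v'_def using that by (intro image_cong) auto
      ultimately show ?thesis by (simp only: oflag_def)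
    qed
    then have "U ` {1..n-1} = oflag n v' ` {1..n-1}" by (intro image_cong refl)
    ultimately show ?case using van by simp
  next
    case (Suc l)
    note U = Suc.prems(2) and v = Suc.prems(3) and Uv = Suc.prems(4)
    let ?k = "Suc k" and ?m = "n - k"
    have k: "?k \<le> n - 1" "?k \<in> {1..n}" "1 \<le> ?k" "?k \<le> n" "2 \<le> ?m" "?m \<le> n" "?m - 1 = n - ?k"
      "?m - 1 < n" "Suc (?m - 1) = ?m" "l = n - 1 - ?k"
      using Suc.hyps(2) n by auto
    have vk: "leading_one n i (v i)" if "i \<in> {1..<?k}" for i using v[of i] that by auto
    have iv: "{1..<?k} = {1..k}" by auto
    \<comment> \<open>A vector with leading one at \<open>?k\<close> pairs to 1 with
      \<open>d\<close>, so the hyperplanes with such a normal are exactly those missing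
      \<open>d\<close>.\<close>
    obtain d where d: "d \<in> Vsp n" "\<And>i. i \<in> {1..<?k} \<Longrightarrow> dotp n d (v i) = 0"
      "\<And>i. i \<in> {?k..n} \<Longrightarrow> d i = (if i = ?k then 1 else 0)"
      using solve_with_tail[OF vk k(3,4), where b = "\<lambda>i. if i = ?k then 1 else 0"] by blast
    have dW: "d \<in> orth n (v ` {1..<?k})" using d by (auto simp: orth_def)
    show ?case
    \<comment> \<open>\<open>H\<close> cuts out the hyperplane with normal \<open>stdvec ?k\<close>,
      the one excluded by the definition of \<open>Tset\<close>.\<close>
    proof (rule flag_functional_propagation[where cf = "\<lambda>U. c (U ` {1..n-1})" and P = U and U = U
          and H = "{u. u ?k = 0}" and d = d and m = ?m and n = n])
      show "vct.subspace {u. u ?k = 0}" by (auto simp: vct.subspace_def vscale_def)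
      show "d \<notin> {u. u ?k = 0}" using d(3)[of ?k] k(4) by simp
      show "d \<in> U ?m" using dW Uv[of k] iv by simp
    next
      fix U' assume U': "full_flag n U'" and agree: "\<forall>j\<in>{?m..n}. U' j = U j"
        and dU': "d \<notin> U' (?m - 1)" and HU': "\<not> U' (?m - 1) \<subseteq> {u. u ?k = 0}"
      let ?A = "U' (?m - 1)" and ?W = "orth n (v ` {1..<?k})"
      have W: "U' ?m = ?W" using agree Uv[of k] iv by simp
      have AW: "?A \<subseteq> ?W" using full_flag_Suc[OF U' k(8)] k(9) W by auto
      have sub: "vct.subspace ?A" by (rule full_flag_subspace[OF U']) simp
      have "vct.span (insert d ?A) = U' (Suc (?m - 1))"
      proof (rule full_flag_no_between[OF U' k(8)])
        show "?A \<subset> vct.span (insert d ?A)" using dU' vct.span_superset by blast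
        show "vct.span (insert d ?A) \<subseteq> U' (Suc (?m - 1))"
          unfolding k(9) W using AW dW by (intro vct.span_minimal subspace_orth) auto
      qed simp
      then have span: "vct.span (insert d ?A) = ?W" unfolding k(9) W .
      have dec: "\<exists>t. u - vscale t d \<in> ?A" if "u \<in> ?W" for u
        using that unfolding span[symmetric] vct.span_insert vct.span_eq_iff[THEN iffD2, OF sub] by blast
      have d1: "d ?k = 1" and d0: "\<And>j. j \<in> {?k<..n} \<Longrightarrow> d j = 0" using d(3) k(4) by auto
      obtain x where x: "leading_one n ?k x" "?A = {u \<in> ?W. dotp n u x = 0}"
        using hyperplane_normal[OF vk k(2) sub AW dU' dec dW d1 d0] by blast
      have "x \<noteq> stdvec ?k"
      proof
        assume "x = stdvec ?k"
        then have "?A \<subseteq> {u. u ?k = 0}" using x(2) by (auto simp: dotp_stdvec_right[OF k(2)])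
        then show False using HU' by blast
      qed
      define v' where "v' = v(?k := x)"
      have v'i: "v' ` {1..i} = v ` {1..i}" if "i \<le> k" for i
        unfolding v'_def using that by (intro image_cong) auto
      show "c (U' ` {1..n-1}) = 0"
      proof (rule Suc.hyps(1)[OF k(10) k(1) U', of v'])
        fix i assume "i \<in> {1..?k}"
        then show "leading_one n i (v' i) \<and> v' i \<noteq> stdvec i"
          using v[of i] x(1) \<open>x \<noteq> stdvec ?k\<close> by (cases "i = ?k") (auto simp: v'_def)
      next
        fix i assume i: "i \<le> ?k"
        show "U' (n - i) = orth n (v' ` {1..i})"
        proof (cases "i = ?k")
          case False
          then have "i \<le> k" "n - i \<in> {?m..n}" using i by auto
          then show ?thesis using agree Uv v'i by simp
        next
          case True
          have "v' ` {1..?k} = insert x (v ` {1..<?k})"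
          proof -
            have "{1..?k} = insert ?k {1..k}" by auto
            then have "v' ` {1..?k} = insert (v' ?k) (v' ` {1..k})" by simp
            then show ?thesis unfolding v'i[OF order.refl] iv by (simp add: v'_def)
          qed
          then have "orth n (v' ` {1..?k}) = {u \<in> ?W. dotp n u x = 0}" by (auto simp: orth_def)
          then show ?thesis using x(2) k(7) True by simp
        qed
      qed
    next
      fix U :: "nat \<Rightarrow> (nat \<Rightarrow> 'a) set" assume "full_flag n U"
      then show "c (U ` {1..n-1}) \<in> U 1" by (rule D1_flag_stalk[OF c _ n])
    next
      fix U :: "nat \<Rightarrow> (nat \<Rightarrow> 'a) set" and i assume "full_flag n U" "i \<in> {1..n-1}"
      then show "(\<Sum>M\<in>between (U (i - 1)) (U (Suc i)). c ((U(i := M)) ` {1..n-1})) = 0"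
        by (rule D1_flag_relation[OF c _ n])
    qed (use U k in auto)
  qed
  show ?thesis
    \<comment> \<open>With an empty prefix the premises only say that \<open>U n\<close> is the
      whole space.\<close>
    by (rule claim[of 0 U undefined]) (use U in \<open>auto simp: full_flag_top orth_def\<close>)
qed

section \<open>Each dual flag meets only its own class\<close>

text \<open>Equal flags mean that, step by step, \<open>y (\<rho> k)\<close> and \<open>v'_k\<close>
  have the same kernel on the complement of \<open>v'_1, ..., v'_{k-1}\<close>. Leading positions
  then force \<open>\<rho> k = k\<close>, and the leading entries 1 force equality of the
  vectors.\<close>

lemma chamber_eq_oflagD:
  assumes v: "v \<in> Tset n" and v': "v' \<in> Tset n" and \<rho>: "\<rho> permutes {1..n}"
    and \<epsilon>: "\<epsilon> \<in> Eset n" and n: "n \<ge> 2"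
    and eq: "chamber n v \<epsilon> \<rho> = oflag n v' ` {1..n-1}"
  shows "\<rho> = id" "v = v'" "\<epsilon> = restrict (\<lambda>_. 1) {1..n-1}"
proof -
  let ?y = "yvec n v \<epsilon>" and ?y' = "yvec n v' (\<lambda>_. 1)"
  have U: "full_flag n (oflag n (?y \<circ> \<rho>))" by (rule full_flag_oflag[OF unitriangular_yvec[OF v] \<rho>])
  have U': "full_flag n (oflag n (?y' \<circ> id))"
    by (rule full_flag_oflag[OF unitriangular_yvec[OF v'] permutes_id])
  have y': "oflag n (?y' \<circ> id) i = oflag n v' i" if "i \<in> {1..n-1}" for i
  proof -
    have "(?y' \<circ> id) ` {1..n-i} = v' ` {1..n-i}"
      using that by (intro image_cong) (auto simp: yvec_def veps_def)
    then show ?thesis by (simp only: oflag_def)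
  qed
  have im: "oflag n (?y' \<circ> id) ` {1..n-1} = oflag n v' ` {1..n-1}" by (intro image_cong refl y')
  have orth: "orth n ((?y \<circ> \<rho>) ` {1..k}) = orth n (v' ` {1..k})" if k: "k \<in> {1..n-1}" for k
  proof -
    have i: "n - k \<in> {1..n-1}" "n - (n - k) = k" "n - k \<le> n" using k by auto
    have mem: "oflag n (?y \<circ> \<rho>) (n - k) \<in> oflag n (?y' \<circ> id) ` {1..n-1}"
      using eq i(1) unfolding im chamber_def by blast
    have "oflag n (?y \<circ> \<rho>) (n - k) = oflag n (?y' \<circ> id) (n - k)"
      by (rule full_flag_mem_imageD[OF U U' i(3) mem]) auto
    also note y'[OF i(1)]
    finally show ?thesis unfolding oflag_def i(2) .
  qed
  have lead: "leading_one n i (?y i)" if "i \<in> {1..n}" for i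
    using unitriangular_yvec[OF v] that by (auto simp: unitriangular_def leading_one_def)
  have lead': "leading_one n i (v' i)" if "i \<in> {1..n-1}" for i
    using v' that unfolding Tset_iff leading_one_def by blast
  have main: "\<rho> k = k \<and> ?y k = v' k" if "k \<in> {1..n-1}" for k
    using that
  proof (induction k rule: less_induct)
    case (less k)
    have k: "1 \<le> k" "k \<le> n" "k \<in> {1..n}" using less.prems by auto
    have IH: "\<rho> i = i" "?y i = v' i" if "i \<in> {1..<k}" for i
      using less.IH[of i] that less.prems by auto
    have vk: "leading_one n i (v' i)" if "i \<in> {1..<k}" for i using lead'[of i] that less.prems by auto
    have ins: "{1..k} = insert k {1..<k}" using k by auto
    have iff: "dotp n u (?y (\<rho> k)) = 0 \<longleftrightarrow> dotp n u (v' k) = 0"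
      if u: "u \<in> Vsp n" "\<And>i. i \<in> {1..<k} \<Longrightarrow> dotp n u (v' i) = 0" for u
    proof -
      have "u \<in> orth n ((?y \<circ> \<rho>) ` {1..k}) \<longleftrightarrow> dotp n u (?y (\<rho> k)) = 0"
        unfolding ins using u IH by (auto simp: orth_def)
      moreover have "u \<in> orth n (v' ` {1..k}) \<longleftrightarrow> dotp n u (v' k) = 0"
        unfolding ins using u by (auto simp: orth_def)
      ultimately show ?thesis unfolding orth[OF less.prems] by simp
    qed
    have \<rho>k: "\<rho> k \<in> {1..n}" using permutes_in_image[OF \<rho>] k(3) by blast
    have "\<not> \<rho> k < k"
    proof
      assume "\<rho> k < k"
      then have "\<rho> (\<rho> k) = \<rho> k" using IH(1)[of "\<rho> k"] \<rho>k by simp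
      then have "\<rho> k = k" using permutes_inj[OF \<rho>] by (simp add: inj_eq)
      then show False using \<open>\<rho> k < k\<close> by simp
    qed
    moreover have "\<not> k < \<rho> k"
    proof
      assume lt: "k < \<rho> k"
      \<comment> \<open>\<open>d\<close> is orthogonal to every vector whose leading position is
        beyond \<open>k\<close>, but pairs to 1 with \<open>v' k\<close>.\<close>
      obtain d where d: "d \<in> Vsp n" "\<And>i. i \<in> {1..<k} \<Longrightarrow> dotp n d (v' i) = 0"
        "\<And>i. i \<in> {k..n} \<Longrightarrow> d i = (if i = k then 1 else 0)"
        using solve_with_tail[OF vk k(1,2), where b = "\<lambda>i. if i = k then 1 else 0"] by blast
      have "dotp n d (?y (\<rho> k)) = (\<Sum>j=\<rho> k..n. d j * ?y (\<rho> k) j)"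
        by (rule dotp_leading[OF lead[OF \<rho>k] \<rho>k])
      also have "\<dots> = 0" using d(3) lt by (intro sum.neutral) auto
      finally have "dotp n d (v' k) = 0" using iff[OF d(1,2)] by blast
      moreover have "dotp n d (v' k) = (\<Sum>j=k..n. if j = k then v' k k else 0)"
        unfolding dotp_leading[OF lead'[OF less.prems] k(3)] using d(3) by (intro sum.cong) auto
      ultimately show False using lead'[OF less.prems] k by (simp add: leading_one_def)
    qed
    ultimately have \<rho>kk: "\<rho> k = k" by simp
    have yk: "leading_one n k (?y k)" and v'k: "leading_one n k (v' k)"
      using lead[OF k(3)] lead'[OF less.prems] by auto
    have "?y k j = v' k j" for j
    proof -
      consider "j \<notin> {1..n}" | "j < k" | "j = k" | "j \<in> {k<..n}" using k by force
      then show ?thesis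
      proof cases
        case 4
        define t where "t = v' k j"
        \<comment> \<open>Pairing with \<open>u\<close> reads off \<open>x j - t\<close> for any
          \<open>x\<close> with leading one at \<open>k\<close>. By the choice of \<open>t\<close>
          it kills \<open>v' k\<close>, so it must kill \<open>?y k\<close>.\<close>
        obtain u where u: "u \<in> Vsp n" "\<And>i. i \<in> {1..<k} \<Longrightarrow> dotp n u (v' i) = 0"
          "\<And>i. i \<in> {k..n} \<Longrightarrow> u i = (if i = k then - t else if i = j then 1 else 0)"
          using solve_with_tail[OF vk k(1,2), where b = "\<lambda>i. if i = k then - t else if i = j then 1 else 0"]
          by blast
        have dot: "dotp n u x = x j - t" if "leading_one n k x" for x
        proof -
          have "dotp n u x = (\<Sum>i=k..n. u i * x i)" by (rule dotp_leading[OF that k(3)])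
          also have "\<dots> = (\<Sum>i\<in>{k, j}. u i * x i)"
            by (rule sum.mono_neutral_right) (use u(3) 4 k in auto)
          also have "\<dots> = u k * x k + u j * x j" using 4 by (subst sum.insert) auto
          also have "\<dots> = x j - t" using u(3)[of k] u(3)[of j] 4 k that by (auto simp: leading_one_def)
          finally show ?thesis .
        qed
        have "dotp n u (?y k) = 0" using iff[OF u(1,2)] dot[OF v'k] unfolding \<rho>kk t_def by simp
        then show ?thesis using dot[OF yk] by (simp add: t_def)
      qed (use yk v'k in \<open>auto simp: leading_one_def Vsp_def\<close>)
    qed
    then show ?case using \<rho>kk by (auto simp: fun_eq_iff)
  qed
  \<comment> \<open>If \<open>\<epsilon> k = 0\<close>, then \<open>v' k\<close> would equal
    \<open>e_k\<close>, which \<open>Tset\<close> forbids.\<close>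
  have e: "\<epsilon> k = 1 \<and> v k = v' k" if k: "k \<in> {1..n-1}" for k
  proof -
    have "k \<noteq> n" using k by auto
    then have "veps v \<epsilon> k = v' k" using main[OF k] by (simp add: yvec_def)
    moreover have "v' k \<noteq> stdvec k" using v' k unfolding Tset_iff by blast
    ultimately have "\<epsilon> k \<noteq> 0" "v k = v' k" by (auto simp: veps_def split: if_splits)
    moreover have "\<epsilon> k \<in> {0, 1}" using \<epsilon> k unfolding Eset_def by (rule PiE_mem)
    ultimately show ?thesis by auto
  qed
  show "v = v'"
    by (rule extensionalityI[of _ "{1..n-1}"]) (use v v' e in \<open>auto simp: Tset_iff\<close>)
  show "\<epsilon> = restrict (\<lambda>_. 1) {1..n-1}"
    by (rule extensionalityI[of _ "{1..n-1}"]) (use \<epsilon> e in \<open>auto simp: Eset_def PiE_iff\<close>)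
  show "\<rho> = id"
  proof
    fix k
    consider "k \<in> {1..n-1}" | "k = n" | "k \<notin> {1..n}" by force
    then show "\<rho> k = id k"
    proof cases
      case 2
      have "\<rho> n \<in> {1..n}" using permutes_in_image[OF \<rho>, of n] n by simp
      moreover have "\<rho> n \<notin> {1..n-1}"
      proof
        assume l: "\<rho> n \<in> {1..n-1}"
        then have "\<rho> (\<rho> n) = \<rho> n" using main by blast
        then have "\<rho> n = n" using permutes_inj[OF \<rho>] by (simp add: inj_eq)
        then show False using l n by auto
      qed
      ultimately show ?thesis using 2 by auto
    qed (use main \<rho> in \<open>auto simp: permutes_not_in\<close>)
  qed
qed

lemma chamber_id:
  assumes "n \<ge> 2"
  shows "chamber n v (restrict (\<lambda>_. 1) {1..n-1}) id = oflag n v ` {1..n-1}"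
  unfolding chamber_def
proof (rule image_cong[OF refl])
  fix i assume "i \<in> {1..n-1}"
  then have "(yvec n v (restrict (\<lambda>_. 1) {1..n-1}) \<circ> id) ` {1..n-i} = v ` {1..n-i}"
    by (intro image_cong) (auto simp: yvec_def veps_def)
  then show "oflag n (yvec n v (restrict (\<lambda>_. 1) {1..n-1}) \<circ> id) i = oflag n v i"
    by (simp only: oflag_def)
qed

text \<open>The flag of \<open>v\<close> is met by a single chamber of a single apartment of its
  class: \<open>\<epsilon>\<close> constantly 1 and \<open>\<rho> = id\<close>. Since coordinate
  \<open>n\<close> of \<open>w\<close> is 1, only the sign remains.\<close>

lemma ctilde_oflag:
  assumes v: "v \<in> Tset n" and v': "v' \<in> Tset n" and n: "n \<ge> 2"
  shows "v \<noteq> v' \<Longrightarrow> ctilde n v (oflag n v' ` {1..n-1}) = 0"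
    and "ctilde n v (oflag n v ` {1..n-1}) n \<noteq> 0"
proof -
  let ?t = "\<lambda>F \<epsilon> \<rho>. single (chamber n v \<epsilon> \<rho>) (vscale (of_int (chi n \<epsilon> \<rho>)) (wvec n (veps v \<epsilon>))) F"
  let ?o = "restrict (\<lambda>_. 1) {1..n-1} :: nat \<Rightarrow> nat"
  have ct: "ctilde n v F = (\<Sum>\<epsilon>\<in>Eset n. \<Sum>\<rho> | \<rho> permutes {1..n}. ?t F \<epsilon> \<rho>)" for F
    unfolding ctilde_apartments[OF n] sum_fun_apply[where t = F] ..
  show "ctilde n v (oflag n v' ` {1..n-1}) = 0" if "v \<noteq> v'"
  proof -
    have "?t (oflag n v' ` {1..n-1}) \<epsilon> \<rho> = 0" if "\<epsilon> \<in> Eset n" "\<rho> permutes {1..n}" for \<epsilon> \<rho>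
      using chamber_eq_oflagD(2)[OF v v' that(2,1) n] \<open>v \<noteq> v'\<close> by (auto simp: single_def)
    then show ?thesis unfolding ct by (intro sum.neutral ballI) simp
  qed
  let ?F = "oflag n v ` {1..n-1}"
  have o: "?o \<in> Eset n" by (auto simp: Eset_def)
  have z: "?t ?F \<epsilon> \<rho> = 0" if "\<epsilon> \<in> Eset n" "\<rho> permutes {1..n}" "\<epsilon> \<noteq> ?o \<or> \<rho> \<noteq> id" for \<epsilon> \<rho>
    using chamber_eq_oflagD(1,3)[OF v v that(2,1) n] that(3) by (auto simp: single_def)
  have "ctilde n v ?F = (\<Sum>\<epsilon>\<in>{?o}. \<Sum>\<rho> | \<rho> permutes {1..n}. ?t ?F \<epsilon> \<rho>)"
    unfolding ct
  proof (rule sum.mono_neutral_right[OF finite_Eset])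
    show "\<forall>\<epsilon>\<in>Eset n - {?o}. (\<Sum>\<rho> | \<rho> permutes {1..n}. ?t ?F \<epsilon> \<rho>) = 0"
      by (intro ballI sum.neutral) (use z in blast)
  qed (use o in blast)
  also have "\<dots> = (\<Sum>\<rho> | \<rho> permutes {1..n}. ?t ?F ?o \<rho>)" by simp
  also have "\<dots> = (\<Sum>\<rho>\<in>{id}. ?t ?F ?o \<rho>)"
  proof (rule sum.mono_neutral_right)
    show "finite {\<rho>. \<rho> permutes {1..n}}" by (simp add: finite_permutations)
    show "{id} \<subseteq> {\<rho>. \<rho> permutes {1..n}}" by (simp add: permutes_id)
    show "\<forall>\<rho>\<in>{\<rho>. \<rho> permutes {1..n}} - {id}. ?t ?F ?o \<rho> = 0" using z[OF o] by blast
  qed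
  also have "\<dots> = vscale (of_int (chi n ?o id)) (wvec n (veps v ?o))"
    using chamber_id[OF n, of v] by (simp add: single_def)
  finally have "ctilde n v ?F n = of_int (chi n ?o id)"
    using wvec_veps(3)[OF v n, of ?o] by (simp add: vscale_def)
  moreover have "chi n ?o id = 1 \<or> chi n ?o id = - 1"
    by (cases "even (\<Sum>j=1..n-1. ?o j)") (simp_all add: chi_def del: restrict_apply)
  ultimately show "ctilde n v ?F n \<noteq> 0" by auto
qed

section \<open>Coordinate \<open>n\<close> at the dual flags, and the basis property\<close>

text \<open>The coefficient is orthogonal to \<open>v_1, ..., v_{n-1}\<close> by the stalk condition
  and to \<open>e_n\<close> by assumption, and these vectors form a basis.\<close>

lemma D1_oflag_eq_0:
  assumes c: "c \<in> D1 n" and v: "v \<in> Tset n" and n: "n \<ge> 2" and z: "c (oflag n v ` {1..n-1}) n = 0"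
  shows "c (oflag n v ` {1..n-1}) = 0"
proof -
  let ?o = "restrict (\<lambda>_. 1) {1..n-1} :: nat \<Rightarrow> nat"
  let ?y = "yvec n v ?o"
  have y: "unitriangular n ?y" by (rule unitriangular_yvec[OF v])
  have "c (oflag n (?y \<circ> id) ` {1..n-1}) \<in> oflag n (?y \<circ> id) 1"
    by (rule D1_flag_stalk[OF c full_flag_oflag[OF y permutes_id] n])
  then have mem: "c (oflag n v ` {1..n-1}) \<in> orth n (?y ` {1..n-1})"
    using chamber_id[OF n, of v] by (simp add: chamber_def oflag_def)
  show ?thesis
  proof (rule unitriangular_unique[OF y])
    show "c (oflag n v ` {1..n-1}) \<in> Vsp n" using mem orth_subset_Vsp by blast
    fix i assume "i \<in> {1..n}"
    then consider "i \<in> {1..n-1}" | "i = n" by force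
    then show "dotp n (c (oflag n v ` {1..n-1})) (?y i) = 0"
    proof cases
      case 1
      then show ?thesis using mem unfolding orth_def by blast
    next
      case 2
      then show ?thesis using z n by (simp add: yvec_def dotp_stdvec_right)
    qed
  qed
qed

lemma D1_subspace: "chn.subspace (D1 n :: ((nat \<Rightarrow> 'a::{field, finite}) set set \<Rightarrow> nat \<Rightarrow> 'a) set)"
proof -
  let ?b = "boundary dim_prec (XV n :: (nat \<Rightarrow> 'a) set set set) (gsys n) (int n - 2)"
  have add: "?b (c + c') = ?b c + ?b c'" for c c'
  proof -
    have "?b (c + c') \<tau> = ?b c \<tau> + ?b c' \<tau>" for \<tau>
      unfolding boundary_apply sum.distrib[symmetric]
      by (intro sum.cong refl) (simp add: signed_def)
    then show ?thesis by (simp add: fun_eq_iff)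
  qed
  have scale: "?b (cscale t c) = cscale t (?b c)" for t c
  proof
    fix \<tau>
    have "(if P then signed k (vscale t u) else 0) = vscale t (if P then signed k u else 0)" for P k u
      by (simp add: signed_def)
    then show "?b (cscale t c) \<tau> = cscale t (?b c) \<tau>"
      unfolding boundary_apply cscale_def vct.scale_sum_right by (intro sum.cong refl) blast
  qed
  have zero: "?b 0 = 0" using scale[of 0 0] by simp
  show ?thesis
    using chain_group_XV_subspace[of n "int n - 2", where 'a = 'a] add scale zero
    unfolding D1_def cycle_group_def chn.subspace_def
    by (simp del: plus_fun_apply zero_fun_apply)
qed

lemma finite_Tset: "finite (Tset n :: (nat \<Rightarrow> nat \<Rightarrow> 'a::{field, finite}) set)"
proof (rule finite_subset)
  show "(Tset n :: (nat \<Rightarrow> nat \<Rightarrow> 'a) set) \<subseteq> {1..n-1} \<rightarrow>\<^sub>E Vsp n"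
    unfolding Tset_iff subset_iff PiE_iff by blast
  show "finite ({1..n-1} \<rightarrow>\<^sub>E (Vsp n :: (nat \<Rightarrow> 'a) set))" by (intro finite_PiE finite_Vsp) simp
qed

theorem theorem2p2:
  fixes n :: nat
  assumes "n \<ge> 2"
  shows "inj_on (ctilde n) (Tset n :: (nat \<Rightarrow> nat \<Rightarrow> 'a::{field, finite}) set)
       \<and> chn.independent (ctilde n ` (Tset n :: (nat \<Rightarrow> nat \<Rightarrow> 'a) set))
       \<and> chn.span (ctilde n ` (Tset n :: (nat \<Rightarrow> nat \<Rightarrow> 'a) set)) = D1 n"
proof (intro conjI)
  let ?T = "Tset n :: (nat \<Rightarrow> nat \<Rightarrow> 'a) set"
  let ?F = "\<lambda>v. oflag n v ` {1..n-1}"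
  have off: "ctilde n v (?F v') = 0" if "v \<in> ?T" "v' \<in> ?T" "v \<noteq> v'" for v v'
    by (rule ctilde_oflag(1)[OF that(1,2) assms that(3)])
  have diag: "ctilde n v (?F v) n \<noteq> 0" if "v \<in> ?T" for v by (rule ctilde_oflag(2)[OF that that assms])
  \<comment> \<open>Coordinate \<open>n\<close> at the dual flag of \<open>v'\<close> isolates the
    coefficient of \<open>v'\<close>, because all other classes vanish there.\<close>
  have eval: "(\<Sum>v\<in>?T. cscale (a v) (ctilde n v)) (?F v') n = a v' * ctilde n v' (?F v') n"
    if v': "v' \<in> ?T" for a v'
  proof -
    have "(\<Sum>v\<in>?T. cscale (a v) (ctilde n v)) (?F v') n = (\<Sum>v\<in>?T. a v * ctilde n v (?F v') n)"
      unfolding sum_fun_apply cscale_def vscale_def ..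
    also have "\<dots> = (\<Sum>v\<in>{v'}. a v * ctilde n v (?F v') n)"
      by (rule sum.mono_neutral_right[OF finite_Tset]) (use v' off[OF _ v'] in auto)
    finally show ?thesis by simp
  qed
  show inj: "inj_on (ctilde n) ?T"
  proof (rule inj_onI, rule ccontr)
    fix v v' assume "v \<in> ?T" "v' \<in> ?T" "ctilde n v = ctilde n v'" "v \<noteq> v'"
    then show False using off[of v v'] diag[of v'] by simp
  qed
  show "chn.independent (ctilde n ` ?T)"
  proof (rule chn.independent_if_scalars_zero)
    show "finite (ctilde n ` ?T)" using finite_Tset by blast
    fix f x assume z: "(\<Sum>x\<in>ctilde n ` ?T. cscale (f x) x) = 0" and "x \<in> ctilde n ` ?T"
    then obtain v where v: "v \<in> ?T" "x = ctilde n v" by blast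
    have "(\<Sum>v\<in>?T. cscale (f (ctilde n v)) (ctilde n v)) = 0"
      using z unfolding sum.reindex[OF inj] by simp
    then have "f (ctilde n v) * ctilde n v (?F v) n = 0" using eval[OF v(1), of "\<lambda>v. f (ctilde n v)"] by simp
    then show "f x = 0" using diag[OF v(1)] v(2) by simp
  qed
  show "chn.span (ctilde n ` ?T) = D1 n"
  proof
    show "chn.span (ctilde n ` ?T) \<subseteq> D1 n"
      using ctilde_in_D1[OF _ assms] by (intro chn.span_minimal D1_subspace) blast
    show "D1 n \<subseteq> chn.span (ctilde n ` ?T)"
    proof
      fix c :: "(nat \<Rightarrow> 'a) set set \<Rightarrow> nat \<Rightarrow> 'a" assume c: "c \<in> D1 n"
      \<comment> \<open>By \<open>eval\<close> these are the only possible coefficients. They make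
        coordinate \<open>n\<close> of \<open>c - s\<close> zero at every dual flag, and hence
        \<open>c - s\<close> itself zero there.\<close>
      define a where "a v = c (?F v) n / ctilde n v (?F v) n" for v
      define s where "s = (\<Sum>v\<in>?T. cscale (a v) (ctilde n v))"
      have s: "s \<in> chn.span (ctilde n ` ?T)"
        unfolding s_def by (intro chn.span_sum chn.span_scale chn.span_base) blast
      have "s \<in> D1 n"
        unfolding s_def using ctilde_in_D1[OF _ assms]
        by (intro chn.subspace_sum[OF D1_subspace] chn.subspace_scale[OF D1_subspace]) blast
      then have cs: "c - s \<in> D1 n" using c by (intro chn.subspace_diff[OF D1_subspace])
      have cz: "(c - s) (?F v) = 0" if v: "v \<in> ?T" for v
      proof (rule D1_oflag_eq_0[OF cs v assms])
        show "(c - s) (?F v) n = 0" using eval[OF v, of a] diag[OF v] by (simp add: s_def a_def)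
      qed
      have "(c - s) \<sigma> = 0" for \<sigma>
      proof (cases "\<sigma> \<in> simplices (XV n) (int n - 2)")
        case True
        then obtain U where U: "full_flag n U" "\<sigma> = U ` {1..n-1}" using simplex_full_flag[OF _ assms] by blast
        show ?thesis unfolding U(2) by (rule D1_vanishing[OF cs assms cz U(1)])
      next
        case False
        then show ?thesis using cs unfolding D1_def cycle_group_def chain_group_def by blast
      qed
      then have "c - s = 0" unfolding fun_eq_iff[of "c - s" 0] zero_fun_apply by blast
      then have "c = s" by (rule iffD1[OF right_minus_eq])
      then show "c \<in> chn.span (ctilde n ` ?T)" using s by simp
    qed
  qed
qed

end
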